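(* Let $(M_1,F_1)$ and $(M_2,F_2)$ be Finsler manifolds, let $f: M_1\times M_2\to(0,\infty)$ be a smooth function, and let $F=\sqrt{F_1^2+f^2F_2^2}$ be the twisted product Finsler metric, defined on $\widetilde M$. Then $F$ has relatively isotropic Landsberg curvature if and only if $F$ is a Landsberg metric.
   Context: A Finsler metric on a smooth manifold $N$ is a function $F:TN\to[0,\infty)$, smooth on the slit tangent bundle ($TN$ minus the zero section), with $F(x,\lambda y)=\lambda F(x,y)$ for $\lambda>0$, and with positive definite Hessian $g_{ij}=\frac12[F^2]_{y^iy^j}$ on the slit tangent bundle; $(g^{ij})$ is the inverse matrix and $y_i=g_{ij}y^j$. Here $(x^i,y^i)$ are induced local coordinates on $TN$, and the summation convention is used. The spray coefficients are $\mathbb G^i=\frac14 g^{ip}\{[F^2]_{x^qy^p}y^q-[F^2]_{x^p}\}$, the Berwald curvature coefficients are $B^{\ l}_{i\ jk}=\frac{\partial^3\mathbb G^l}{\partial y^i\partial y^j\partial y^k}$, and the Landsberg curvature coefficients are $L_{ijk}=-\frac12 y_l B^{\ l}_{i\ jk}$. $F$ is a Landsberg metric if $L_{ijk}=0$ identically. The Cartan torsion coefficients are $C_{ijk}=\frac12\frac{\partial g_{ij}}{\partial y^k}$. $F$ has relatively isotropic Landsberg curvature if there is a scalar function $c=c(x)$ on the manifold with $L_{ijk}+c(x)F\,C_{ijk}=0$ for all indices. Twisted product: with $m=\dim M_1$, $n=\dim M_2$, local coordinates on $M=M_1\times M_2$ are product coordinates $x=(x_1,x_2)$, $x_1=(x^1,\dots,x^m)$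 on $M_1$, $x_2=(x^{m+1},\dots,x^{m+n})$ on $M_2$, with fibre coordinates $y=(y_1,y_2)$ accordingly. $\widetilde M=\widetilde M_1\times\widetilde M_2$ where $\widetilde M_i$ is $TM_i$ minus its zero section. The twisted product Finsler metric is $F(x,y)=\sqrt{F_1^2(x_1,y_1)+f^2(x_1,x_2)F_2^2(x_2,y_2)}$ on $\widetilde M$; its curvature quantities are computed on $\widetilde M$, with indices $\alpha,\beta,\gamma,\lambda,\mu,\nu$ running from $1$ to $m+n$, by $G_{\alpha\beta}=\frac12[F^2]_{y^\alpha y^\beta}$ with inverse matrix $(G^{\alpha\beta})$, spray coefficients $\mathbb G^\alpha=\frac14 G^{\alpha\mu}\{[F^2]_{x^\nu y^\mu}y^\nu-[F^2]_{x^\mu}\}$, Berwald curvature coefficients $B^{\ \lambda}_{\alpha\ \beta\gamma}=\frac{\partial^3\mathbb G^\lambda}{\partial y^\alpha\partial y^\beta\partial y^\gamma}$, Landsberg curvature coefficients $L_{\alpha\beta\gamma}=-\frac12 G_{\lambda\mu}y^\mu B^{\ \lambda}_{\alpha\ \beta\gamma}$, and Cartan torsion coefficients $C_{\alpha\beta\gamma}=\frac12\frac{\partial G_{\alpha\beta}}{\partial y^\gamma}$. Thus the twisted product $F$ is a Landsberg metric if $L_{\alpha\beta\gamma}=0$ on $\widetilde M$ for all indices, and it has relatively isotropic Landsberg curvature if there is a scalar function $c=c(x)$ on $M$ with $L_{\alpha\beta\gamma}+c(x)F\,C_{\alpha\beta\gamma}=0$ on $\widetilde M$ for all indices. *)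

theory Defs
  imports "HOL-Analysis.Analysis"
begin

section \<open>Smooth functions\<close>

text \<open>Only used for open \<open>S\<close>.\<close>

primrec Ck_on :: "nat \<Rightarrow> 'a::real_normed_vector set \<Rightarrow> ('a \<Rightarrow> 'b::real_normed_vector) \<Rightarrow> bool" where
  "Ck_on 0 S f \<longleftrightarrow> continuous_on S f"
| "Ck_on (Suc k) S f \<longleftrightarrow>
     (\<forall>x\<in>S. f differentiable (at x)) \<and> (\<forall>v. Ck_on k S (\<lambda>x. frechet_derivative f (at x) v))"

definition smooth_on :: "'a::real_normed_vector set \<Rightarrow> ('a \<Rightarrow> 'b::real_normed_vector) \<Rightarrow> bool" where
  "smooth_on S f \<longleftrightarrow> (\<forall>k. Ck_on k S f)"


section \<open>Manifolds and tangent bundles\<close>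

text \<open>The points of a manifold are the elements of a topological type. A chart is an open set
  together with a coordinate map, which is arbitrary outside that set. Any smooth atlas may present
  the smooth structure, in particular the maximal one.\<close>

type_synonym ('a, 'm) chart = "'a set \<times> ('a \<Rightarrow> real^'m)"

definition chart_inv :: "('a, 'm::finite) chart \<Rightarrow> real^'m \<Rightarrow> 'a" where
  "chart_inv c = inv_into (fst c) (snd c)"

definition is_chart :: "('a::topological_space, 'm::finite) chart \<Rightarrow> bool" where
  "is_chart c \<longleftrightarrow> open (fst c) \<and> open (snd c ` fst c) \<and>
     homeomorphism (fst c) (snd c ` fst c) (snd c) (chart_inv c)"

definition transition :: "('a, 'm::finite) chart \<Rightarrow> ('a, 'm) chart \<Rightarrow> real^'m \<Rightarrow> real^'m" where
  "transition c d = snd d \<circ> chart_inv c"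

definition smooth_atlas :: "('a::topological_space, 'm::finite) chart set \<Rightarrow> bool" where
  "smooth_atlas A \<longleftrightarrow> (\<forall>c\<in>A. is_chart c) \<and> (\<Union>c\<in>A. fst c) = UNIV \<and>
     (\<forall>c\<in>A. \<forall>d\<in>A. smooth_on (snd c ` (fst c \<inter> fst d)) (transition c d))"

text \<open>A tangent vector at \<open>p\<close> is the family of its components in all charts around \<open>p\<close>, related by
  the Jacobians of the transition maps. The family is set to \<open>0\<close> at all other charts, so that
  distinct families are distinct vectors and the zero vector is the zero family.\<close>

type_synonym ('a, 'm) tvec = "('a, 'm) chart \<Rightarrow> real^'m"

definition tangent_space :: "('a, 'm::finite) chart set \<Rightarrow> 'a \<Rightarrow> ('a, 'm) tvec set" where
  "tangent_space A p = {v.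
     (\<forall>c\<in>A. \<forall>d\<in>A. p \<in> fst c \<longrightarrow> p \<in> fst d \<longrightarrow>
        v d = frechet_derivative (transition c d) (at (snd c p)) (v c)) \<and>
     (\<forall>c. \<not> (c \<in> A \<and> p \<in> fst c) \<longrightarrow> v c = 0)}"

definition tangent_bundle :: "('a, 'm::finite) chart set \<Rightarrow> ('a \<times> ('a, 'm) tvec) set" where
  "tangent_bundle A = {(p, v). v \<in> tangent_space A p}"

definition slit_bundle :: "('a, 'm::finite) chart set \<Rightarrow> ('a \<times> ('a, 'm) tvec) set" where
  "slit_bundle A = {(p, v). v \<in> tangent_space A p \<and> v \<noteq> (\<lambda>_. 0)}"

text \<open>The induced coordinates \<open>(x, y)\<close> on the part of the tangent bundle over a chart, and
  their inverse.\<close>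

definition induced :: "('a, 'm::finite) chart \<Rightarrow> 'a \<times> ('a, 'm) tvec \<Rightarrow> (real^'m) \<times> (real^'m)" where
  "induced c = (\<lambda>(p, v). (snd c p, v c))"

definition induced_inv ::
  "('a, 'm::finite) chart set \<Rightarrow> ('a, 'm) chart \<Rightarrow> (real^'m) \<times> (real^'m) \<Rightarrow> 'a \<times> ('a, 'm) tvec" where
  "induced_inv A c = inv_into {t \<in> tangent_bundle A. fst t \<in> fst c} (induced c)"


section \<open>Curvature quantities in coordinates\<close>

text \<open>Here \<open>F\<close> is the coordinate expression of a metric, a function of \<open>z = (x, y)\<close>.\<close>

definition dx :: "'k::finite \<Rightarrow> ((real^'k) \<times> (real^'k) \<Rightarrow> real) \<Rightarrow> (real^'k) \<times> (real^'k) \<Rightarrow> real" where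
  "dx i E = (\<lambda>(x, y). deriv (\<lambda>t. E (x + t *\<^sub>R axis i 1, y)) 0)"

definition dy :: "'k::finite \<Rightarrow> ((real^'k) \<times> (real^'k) \<Rightarrow> real) \<Rightarrow> (real^'k) \<times> (real^'k) \<Rightarrow> real" where
  "dy i E = (\<lambda>(x, y). deriv (\<lambda>t. E (x, y + t *\<^sub>R axis i 1)) 0)"

definition fundamental_tensor ::
  "((real^'k) \<times> (real^'k) \<Rightarrow> real) \<Rightarrow> (real^'k) \<times> (real^'k) \<Rightarrow> real^'k^'k::finite" where
  "fundamental_tensor F z = (\<chi> i j. 1/2 * dy j (dy i (\<lambda>z. (F z)\<^sup>2)) z)"

definition spray ::
  "((real^'k) \<times> (real^'k) \<Rightarrow> real) \<Rightarrow> 'k::finite \<Rightarrow> (real^'k) \<times> (real^'k) \<Rightarrow> real" where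
  "spray F i z = 1/4 * (\<Sum>p\<in>UNIV. matrix_inv (fundamental_tensor F z) $ i $ p *
     ((\<Sum>q\<in>UNIV. dy p (dx q (\<lambda>z. (F z)\<^sup>2)) z * snd z $ q) - dx p (\<lambda>z. (F z)\<^sup>2) z))"

text \<open>\<open>berwald F l i j k\<close> is the coefficient with upper index \<open>l\<close> and lower indices \<open>i, j, k\<close>.\<close>

definition berwald ::
  "((real^'k) \<times> (real^'k) \<Rightarrow> real) \<Rightarrow> 'k::finite \<Rightarrow> 'k \<Rightarrow> 'k \<Rightarrow> 'k \<Rightarrow> (real^'k) \<times> (real^'k) \<Rightarrow> real" where
  "berwald F l i j k = dy k (dy j (dy i (spray F l)))"

definition landsberg ::
  "((real^'k) \<times> (real^'k) \<Rightarrow> real) \<Rightarrow> 'k::finite \<Rightarrow> 'k \<Rightarrow> 'k \<Rightarrow> (real^'k) \<times> (real^'k) \<Rightarrow> real" where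
  "landsberg F i j k z = - 1/2 * (\<Sum>l\<in>UNIV. \<Sum>m\<in>UNIV.
     fundamental_tensor F z $ l $ m * snd z $ m * berwald F l i j k z)"

definition cartan ::
  "((real^'k) \<times> (real^'k) \<Rightarrow> real) \<Rightarrow> 'k::finite \<Rightarrow> 'k \<Rightarrow> 'k \<Rightarrow> (real^'k) \<times> (real^'k) \<Rightarrow> real" where
  "cartan F i j k z = 1/2 * dy k (\<lambda>z. fundamental_tensor F z $ i $ j) z"


section \<open>Finsler metrics\<close>

definition finsler_metric ::
  "('a::topological_space, 'm::finite) chart set \<Rightarrow> ('a \<times> ('a, 'm) tvec \<Rightarrow> real) \<Rightarrow> bool" where
  "finsler_metric A F \<longleftrightarrow>
     (\<forall>t\<in>tangent_bundle A. 0 \<le> F t) \<and>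
     (\<forall>(p, v)\<in>tangent_bundle A. \<forall>r>0. F (p, \<lambda>c. r *\<^sub>R v c) = r * F (p, v)) \<and>
     (\<forall>c\<in>A. smooth_on ((snd c ` fst c) \<times> (UNIV - {0})) (F \<circ> induced_inv A c)) \<and>
     (\<forall>c\<in>A. \<forall>z\<in>(snd c ` fst c) \<times> (UNIV - {0}). \<forall>w. w \<noteq> 0 \<longrightarrow>
        0 < w \<bullet> (fundamental_tensor (F \<circ> induced_inv A c) z *v w))"


section \<open>Twisted products\<close>

text \<open>A vector \<open>real^('m + 'n)\<close> is a pair of a vector of \<open>real^'m\<close> and a vector of \<open>real^'n\<close>, so the
  index type \<open>'m + 'n\<close> indexes product coordinates.\<close>

definition join :: "real^'m::finite \<Rightarrow> real^'n::finite \<Rightarrow> real^('m + 'n)" where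
  "join u w = (\<chi> i. case i of Inl a \<Rightarrow> u $ a | Inr b \<Rightarrow> w $ b)"

definition left_part :: "real^('m::finite + 'n::finite) \<Rightarrow> real^'m" where
  "left_part u = (\<chi> a. u $ Inl a)"

definition right_part :: "real^('m::finite + 'n::finite) \<Rightarrow> real^'n" where
  "right_part u = (\<chi> b. u $ Inr b)"

definition product_smooth ::
  "('a, 'm::finite) chart set \<Rightarrow> ('b, 'n::finite) chart set \<Rightarrow> ('a \<times> 'b \<Rightarrow> real) \<Rightarrow> bool" where
  "product_smooth A1 A2 f \<longleftrightarrow> (\<forall>c1\<in>A1. \<forall>c2\<in>A2.
     smooth_on ((snd c1 ` fst c1) \<times> (snd c2 ` fst c2)) (\<lambda>(x1, x2). f (chart_inv c1 x1, chart_inv c2 x2)))"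

text \<open>A tangent vector to the product is a pair of tangent vectors to the factors.\<close>

definition twisted_product ::
  "('a \<times> ('a, 'm::finite) tvec \<Rightarrow> real) \<Rightarrow> ('b \<times> ('b, 'n::finite) tvec \<Rightarrow> real) \<Rightarrow> ('a \<times> 'b \<Rightarrow> real) \<Rightarrow>
   ('a \<times> ('a, 'm) tvec) \<times> ('b \<times> ('b, 'n) tvec) \<Rightarrow> real" where
  "twisted_product F1 F2 f =
     (\<lambda>(t1, t2). sqrt ((F1 t1)\<^sup>2 + (f (fst t1, fst t2))\<^sup>2 * (F2 t2)\<^sup>2))"

definition product_induced ::
  "('a, 'm::finite) chart \<Rightarrow> ('b, 'n::finite) chart \<Rightarrow>
   ('a \<times> ('a, 'm) tvec) \<times> ('b \<times> ('b, 'n) tvec) \<Rightarrow> (real^('m + 'n)) \<times> (real^('m + 'n))" where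
  "product_induced c1 c2 = (\<lambda>(t1, t2).
     (join (fst (induced c1 t1)) (fst (induced c2 t2)), join (snd (induced c1 t1)) (snd (induced c2 t2))))"

definition product_induced_inv ::
  "('a, 'm::finite) chart set \<Rightarrow> ('b, 'n::finite) chart set \<Rightarrow> ('a, 'm) chart \<Rightarrow> ('b, 'n) chart \<Rightarrow>
   (real^('m + 'n)) \<times> (real^('m + 'n)) \<Rightarrow> ('a \<times> ('a, 'm) tvec) \<times> ('b \<times> ('b, 'n) tvec)" where
  "product_induced_inv A1 A2 c1 c2 = (\<lambda>(x, y).
     (induced_inv A1 c1 (left_part x, left_part y), induced_inv A2 c2 (right_part x, right_part y)))"

definition landsberg_metric ::
  "('a, 'm::finite) chart set \<Rightarrow> ('b, 'n::finite) chart set \<Rightarrow>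
   (('a \<times> ('a, 'm) tvec) \<times> ('b \<times> ('b, 'n) tvec) \<Rightarrow> real) \<Rightarrow> bool" where
  "landsberg_metric A1 A2 F \<longleftrightarrow>
     (\<forall>c1\<in>A1. \<forall>c2\<in>A2. \<forall>t1\<in>slit_bundle A1. \<forall>t2\<in>slit_bundle A2.
        fst t1 \<in> fst c1 \<longrightarrow> fst t2 \<in> fst c2 \<longrightarrow>
        (\<forall>\<alpha> \<beta> \<gamma>. landsberg (F \<circ> product_induced_inv A1 A2 c1 c2) \<alpha> \<beta> \<gamma>
           (product_induced c1 c2 (t1, t2)) = 0))"

definition relatively_isotropic_landsberg ::
  "('a, 'm::finite) chart set \<Rightarrow> ('b, 'n::finite) chart set \<Rightarrow>
   (('a \<times> ('a, 'm) tvec) \<times> ('b \<times> ('b, 'n) tvec) \<Rightarrow> real) \<Rightarrow> bool" where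
  "relatively_isotropic_landsberg A1 A2 F \<longleftrightarrow> (\<exists>c :: 'a \<times> 'b \<Rightarrow> real.
     (\<forall>c1\<in>A1. \<forall>c2\<in>A2. \<forall>t1\<in>slit_bundle A1. \<forall>t2\<in>slit_bundle A2.
        fst t1 \<in> fst c1 \<longrightarrow> fst t2 \<in> fst c2 \<longrightarrow>
        (\<forall>\<alpha> \<beta> \<gamma>. landsberg (F \<circ> product_induced_inv A1 A2 c1 c2) \<alpha> \<beta> \<gamma>
             (product_induced c1 c2 (t1, t2))
           + c (fst t1, fst t2) * F (t1, t2)
             * cartan (F \<circ> product_induced_inv A1 A2 c1 c2) \<alpha> \<beta> \<gamma>
                 (product_induced c1 c2 (t1, t2)) = 0)))"

end

theory Submission
  imports Defs
begin

text \<open>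
  Write \<open>E = F\<^sup>2 = F1\<^sup>2 + f\<^sup>2 F2\<^sup>2\<close>. Only one direction has content: if \<open>L + c F C = 0\<close> for some \<open>c\<close>,
  then \<open>L = 0\<close>. Fix a base point; the number \<open>c\<close> is then fixed, and the equation holds for all
  pairs \<open>(y1, y2)\<close> of nonzero fibre coordinates. The idea is to rescale one of the two and to observe
  that \<open>L\<close> changes polynomially in the scale, while \<open>F\<close> is the square root of a sum of two squares.

  The fundamental tensor of \<open>F\<close> is block diagonal with blocks \<open>g1(y1)\<close> and \<open>f\<^sup>2 g2(y2)\<close>. So the Cartan
  torsion vanishes unless its three indices belong to the same factor, and in that case it depends on
  the fibre coordinate of that factor only. The spray coefficients are
  \<open>G^i = G1^i(y1) + b^i(y1) F2\<^sup>2(y2)\<close> in the first factor and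
  \<open>G^a = A^a(y2) + w^a(y2) l(y1)\<close> with a linear form \<open>l\<close> in the second one (\<open>spray_left\<close>,
  \<open>spray_right\<close>). Three vertical derivatives and a contraction with \<open>y\<close> give the following.

  \<^item> If all indices belong to the first factor, \<open>G^a\<close> contributes nothing since it is affine in \<open>y1\<close>,
    and \<open>L = a + b F2\<^sup>2(y2)\<close> with \<open>a\<close>, \<open>b\<close> independent of \<open>y2\<close> (\<open>landsberg_left_affine\<close>). Replacing
    \<open>y2\<close> by \<open>s y2\<close> turns the equation into \<open>a + b' s\<^sup>2 + k sqrt (P + Q s\<^sup>2) = 0\<close> for all \<open>s > 0\<close>, where
    \<open>k = c C\<close>, \<open>P = F1\<^sup>2\<close> and \<open>Q = f\<^sup>2 F2\<^sup>2\<close>.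
  \<^item> If all indices belong to the second factor, \<open>L\<close> is affine in the scale of \<open>y1\<close>
    (\<open>landsberg_right_affine\<close>), and replacing \<open>y1\<close> by \<open>s y1\<close> gives
    \<open>a + b s + k sqrt (P s\<^sup>2 + Q) = 0\<close> for all \<open>s > 0\<close>.

  Squaring and comparing coefficients gives \<open>k = 0\<close> in both cases, because \<open>P\<close> and \<open>Q\<close> are positive:
  a Finsler metric is positive off the zero section since \<open>F\<^sup>2 = g(y, y)\<close> by Euler's relation. Hence
  \<open>c C = 0\<close> for all indices, and \<open>L = - c F C = 0\<close>.

  The calculus behind this consists of two things. The spray coefficients of \<open>F1\<close> and \<open>F2\<close> have to be
  smooth, because a partial derivative of a sum splits only for differentiable summands; the inverse
  fundamental tensor is smooth by Cramer's rule. And every nonzero coordinate vector over a chart has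
  to come from a tangent vector, so that the coordinate expression of \<open>F\<close> is a square root of the
  stated form on an open set; this is the chain rule for the transition maps.
\<close>

section \<open>Smooth functions and matrix inversion\<close>

text \<open>The formulas for derivatives of sums, products and inverses hold only on \<open>S\<close>, while the
  definition of \<open>Ck_on\<close> speaks of the derivative as a function on the whole space. This rule lets
  the formulas replace the derivative.\<close>
lemma Ck_on_cong:
  assumes "open S" "\<And>x. x \<in> S \<Longrightarrow> f x = g x" "Ck_on k S f"
  shows "Ck_on k S g"
  using assms(2,3)
proof (induction k arbitrary: f g)
  case 0
  then show ?case by (simp cong: continuous_on_cong)
next
  case (Suc k)
  have *: "(g has_derivative frechet_derivative f (at x)) (at x)" if "x \<in> S" for x
  proof -
    have "(f has_derivative frechet_derivative f (at x)) (at x)"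
      using Suc.prems(2) that by (simp add: frechet_derivative_works)
    then show ?thesis
      using has_derivative_transform_within_open[OF _ assms(1) that] Suc.prems(1) by blast
  qed
  show ?case
    unfolding Ck_on.simps
  proof (intro conjI ballI allI)
    fix x assume "x \<in> S" from *[OF this] show "g differentiable (at x)"
      by (rule differentiableI)
  next
    fix v
    have "Ck_on k S (\<lambda>x. frechet_derivative f (at x) v)"
      using Suc.prems(2) by simp
    moreover have "frechet_derivative f (at x) v = frechet_derivative g (at x) v" if "x \<in> S" for x
      using frechet_derivative_at[OF *[OF that]] by simp
    ultimately show "Ck_on k S (\<lambda>x. frechet_derivative g (at x) v)"
      by (rule Suc.IH[rotated])
  qed
qed

lemma Ck_on_SucD: "Ck_on (Suc k) S f \<Longrightarrow> Ck_on k S f"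
proof (induction k arbitrary: f)
  case 0
  then show ?case
    by (auto intro!: continuous_at_imp_continuous_on differentiable_imp_continuous_within)
next
  case (Suc k)
  have "f differentiable (at x)" if "x \<in> S" for x
    using Suc.prems that unfolding Ck_on.simps(2)[of "Suc k"] by blast
  moreover have "Ck_on k S (\<lambda>x. frechet_derivative f (at x) v)" for v
    by (rule Suc.IH) (use Suc.prems in \<open>unfold Ck_on.simps(2)[of "Suc k"], blast\<close>)
  ultimately show ?case unfolding Ck_on.simps(2)[of k] by blast
qed

lemma Ck_on_SucI:
  assumes "open S" "\<And>x. x \<in> S \<Longrightarrow> (f has_derivative D x) (at x)" "\<And>v. Ck_on k S (\<lambda>x. D x v)"
  shows "Ck_on (Suc k) S f"
  unfolding Ck_on.simps
proof (intro conjI ballI allI)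
  fix x assume "x \<in> S" from assms(2)[OF this] show "f differentiable (at x)"
    by (rule differentiableI)
next
  fix v
  show "Ck_on k S (\<lambda>x. frechet_derivative f (at x) v)"
    by (rule Ck_on_cong[OF assms(1) _ assms(3)[of v]])
      (simp add: frechet_derivative_at[OF assms(2), symmetric])
qed

lemma Ck_on_SucE:
  assumes "Ck_on (Suc k) S f" "x \<in> S"
  shows "(f has_derivative frechet_derivative f (at x)) (at x)"
  using assms by (simp add: frechet_derivative_works)

lemma Ck_on_const: "open S \<Longrightarrow> Ck_on k S (\<lambda>x. c)"
proof (induction k arbitrary: c)
  case (Suc k)
  show ?case by (rule Ck_on_SucI[OF Suc.prems has_derivative_const]) (rule Suc.IH[OF Suc.prems])
qed auto

lemma Ck_on_linear: "open S \<Longrightarrow> bounded_linear f \<Longrightarrow> Ck_on k S f"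
proof (cases k)
  case (Suc j)
  assume "open S" "bounded_linear f"
  then show ?thesis unfolding Suc
    by (intro Ck_on_SucI[where D="\<lambda>x. f"] Ck_on_const bounded_linear_imp_has_derivative)
qed (simp add: linear_continuous_on)

lemma Ck_on_add:
  assumes "open S" "Ck_on k S f" "Ck_on k S g"
  shows "Ck_on k S (\<lambda>x. f x + g x)"
  using assms(2,3)
proof (induction k arbitrary: f g)
  case (Suc k)
  show ?case
    by (rule Ck_on_SucI[OF assms(1) has_derivative_add[OF Ck_on_SucE[OF Suc.prems(1)] Ck_on_SucE[OF Suc.prems(2)]]])
      (use Suc in auto)
qed (auto intro: continuous_intros)

text \<open>Closure has to be proved at each finite order, not for smooth functions at once: in the product
  rule the factors themselves occur, with one order to spare, next to their derivatives.\<close>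
lemma Ck_on_mult:
  fixes f g :: "'a::real_normed_vector \<Rightarrow> real"
  assumes "open S" "Ck_on k S f" "Ck_on k S g"
  shows "Ck_on k S (\<lambda>x. f x * g x)"
  using assms(2,3)
proof (induction k arbitrary: f g)
  case (Suc k)
  show ?case
  proof (rule Ck_on_SucI[OF assms(1) Deriv.has_derivative_mult[OF Ck_on_SucE[OF Suc.prems(1)] Ck_on_SucE[OF Suc.prems(2)]]])
    fix v
    show "Ck_on k S (\<lambda>x. f x * frechet_derivative g (at x) v + frechet_derivative f (at x) v * g x)"
      using Suc.prems by (intro Ck_on_add[OF assms(1)] Suc.IH) (auto intro: Ck_on_SucD)
  qed
qed (auto intro: continuous_intros)

lemma Ck_on_inverse:
  fixes f :: "'a::real_normed_vector \<Rightarrow> real"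
  assumes "open S" "Ck_on k S f" "\<And>x. x \<in> S \<Longrightarrow> f x \<noteq> 0"
  shows "Ck_on k S (\<lambda>x. inverse (f x))"
  using assms(2)
proof (induction k)
  case (Suc k)
  show ?case
  proof (rule Ck_on_SucI[OF assms(1) Deriv.has_derivative_inverse[OF assms(3) Ck_on_SucE[OF Suc.prems(1)]]])
    fix v
    have i: "Ck_on k S (\<lambda>x. inverse (f x))" using Suc Ck_on_SucD by blast
    have d: "Ck_on k S (\<lambda>x. frechet_derivative f (at x) v)" using Suc.prems by simp
    have "Ck_on k S (\<lambda>x. (-1) * (inverse (f x) * frechet_derivative f (at x) v * inverse (f x)))"
      by (intro Ck_on_mult[OF assms(1)] i d Ck_on_const[OF assms(1)])
    then show "Ck_on k S (\<lambda>x. - (inverse (f x) * frechet_derivative f (at x) v * inverse (f x)))"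
      by simp
  qed
qed (use assms(3) in \<open>auto intro: continuous_intros\<close>)

lemma smooth_on_cong:
  "open S \<Longrightarrow> (\<And>x. x \<in> S \<Longrightarrow> f x = g x) \<Longrightarrow> smooth_on S f \<Longrightarrow> smooth_on S g"
  unfolding smooth_on_def using Ck_on_cong[of S f g] by simp

lemma smooth_on_const: "open S \<Longrightarrow> smooth_on S (\<lambda>x. c)"
  by (simp add: smooth_on_def Ck_on_const)

lemma smooth_on_linear: "open S \<Longrightarrow> bounded_linear f \<Longrightarrow> smooth_on S f"
  by (simp add: smooth_on_def Ck_on_linear)

lemma smooth_on_add: "open S \<Longrightarrow> smooth_on S f \<Longrightarrow> smooth_on S g \<Longrightarrow> smooth_on S (\<lambda>x. f x + g x)"
  by (simp add: smooth_on_def Ck_on_add)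

lemma smooth_on_mult:
  fixes f g :: "'a::real_normed_vector \<Rightarrow> real"
  shows "open S \<Longrightarrow> smooth_on S f \<Longrightarrow> smooth_on S g \<Longrightarrow> smooth_on S (\<lambda>x. f x * g x)"
  by (simp add: smooth_on_def Ck_on_mult)

lemma smooth_on_diff:
  fixes f g :: "'a::real_normed_vector \<Rightarrow> real"
  assumes "open S" "smooth_on S f" "smooth_on S g"
  shows "smooth_on S (\<lambda>x. f x - g x)"
  using smooth_on_add[OF assms(1,2) smooth_on_mult[OF assms(1) smooth_on_const[OF assms(1), of "-1"] assms(3)]]
  by simp

lemma smooth_on_inverse:
  fixes f :: "'a::real_normed_vector \<Rightarrow> real"
  shows "open S \<Longrightarrow> smooth_on S f \<Longrightarrow> (\<And>x. x \<in> S \<Longrightarrow> f x \<noteq> 0) \<Longrightarrow> smooth_on S (\<lambda>x. inverse (f x))"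
  by (simp add: smooth_on_def Ck_on_inverse)

lemma smooth_on_power2:
  fixes f :: "'a::real_normed_vector \<Rightarrow> real"
  shows "open S \<Longrightarrow> smooth_on S f \<Longrightarrow> smooth_on S (\<lambda>x. (f x)\<^sup>2)"
  by (simp add: power2_eq_square smooth_on_mult)

lemma smooth_on_sum:
  "open S \<Longrightarrow> (\<And>i. i \<in> I \<Longrightarrow> smooth_on S (f i)) \<Longrightarrow> smooth_on S (\<lambda>x. \<Sum>i\<in>I. f i x)"
  by (induction I rule: infinite_finite_induct) (auto intro: smooth_on_const smooth_on_add)

lemma smooth_on_prod:
  fixes f :: "'i \<Rightarrow> 'a::real_normed_vector \<Rightarrow> real"
  shows "open S \<Longrightarrow> (\<And>i. i \<in> I \<Longrightarrow> smooth_on S (f i)) \<Longrightarrow> smooth_on S (\<lambda>x. \<Prod>i\<in>I. f i x)"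
  by (induction I rule: infinite_finite_induct) (auto intro: smooth_on_const smooth_on_mult)

lemma smooth_on_imp_differentiable: "smooth_on S f \<Longrightarrow> x \<in> S \<Longrightarrow> f differentiable (at x)"
  unfolding smooth_on_def by (drule spec[of _ "Suc 0"]) simp

lemma smooth_on_frechet_derivative: "smooth_on S f \<Longrightarrow> smooth_on S (\<lambda>x. frechet_derivative f (at x) v)"
  unfolding smooth_on_def
proof
  fix k assume "\<forall>k. Ck_on k S f"
  then have "Ck_on (Suc k) S f" ..
  then show "Ck_on k S (\<lambda>x. frechet_derivative f (at x) v)" by simp
qed

lemmas smooth_on_intros = smooth_on_const smooth_on_add smooth_on_mult smooth_on_diff
  smooth_on_power2 smooth_on_sum smooth_on_prod

lemma smooth_on_det:
  fixes A :: "'a::real_normed_vector \<Rightarrow> real^'k^'k::finite"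
  assumes "open S" "\<And>i j. smooth_on S (\<lambda>z. A z $ i $ j)"
  shows "smooth_on S (\<lambda>z. det (A z))"
  unfolding det_def using assms by (intro smooth_on_intros) auto

lemma matrix_mult_component:
  "(A ** B) $ i $ j = (\<Sum>k\<in>UNIV. A $ i $ k * B $ k $ j)"
  by (simp add: matrix_matrix_mult_def)

lemma matrix_inv_eqI:
  fixes A B :: "real^'k^'k::finite"
  assumes "A ** B = mat 1"
  shows "matrix_inv A = B"
proof -
  have BA: "B ** A = mat 1"
    using assms matrix_left_right_inverse by blast
  have AM: "A ** matrix_inv A = mat 1"
    unfolding matrix_inv_def by (rule someI2[of _ B]) (simp_all add: assms BA)
  have "matrix_inv A = B ** (A ** matrix_inv A)"
    by (simp add: matrix_mul_assoc BA)
  also have "\<dots> = B" by (simp only: AM matrix_mul_rid)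
  finally show ?thesis .
qed

lemma matrix_inv_right:
  fixes A :: "real^'k^'k::finite"
  assumes "invertible A"
  shows "A ** matrix_inv A = mat 1"
  using assms matrix_inv_eqI unfolding invertible_def by metis

text \<open>By Cramer's rule each entry of the inverse is a quotient of two determinants, and a determinant
  is a polynomial in the entries.\<close>
lemma smooth_on_matrix_inv:
  fixes A :: "'a::real_normed_vector \<Rightarrow> real^'k^'k::finite"
  assumes S: "open S" and A: "\<And>i j. smooth_on S (\<lambda>z. A z $ i $ j)"
    and inv: "\<And>z. z \<in> S \<Longrightarrow> invertible (A z)"
  shows "smooth_on S (\<lambda>z. matrix_inv (A z) $ i $ p)"
proof -
  define M where "M z = (\<chi> a j. if j = i then axis p 1 $ a else A z $ a $ j)" for z
  have M: "smooth_on S (\<lambda>z. M z $ a $ j)" for a j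
    unfolding M_def by (cases "j = i") (auto intro: smooth_on_const S A)
  have d: "det (A z) \<noteq> 0" if "z \<in> S" for z
    using inv[OF that] invertible_det_nz by blast
  have "smooth_on S (\<lambda>z. det (M z) * inverse (det (A z)))"
    using S A M d by (intro smooth_on_mult smooth_on_inverse smooth_on_det)
  moreover have "det (M z) * inverse (det (A z)) = matrix_inv (A z) $ i $ p" if "z \<in> S" for z
  proof -
    have "A z *v (matrix_inv (A z) *v axis p 1) = axis p 1"
      using inv[OF that] by (simp add: matrix_vector_mul_assoc matrix_inv_right)
    then have "matrix_inv (A z) *v axis p 1 =
        (\<chi> k. det (\<chi> a j. if j = k then axis p 1 $ a else A z $ a $ j) / det (A z))"
      using cramer[OF d[OF that]] by blast
    then have "(matrix_inv (A z) *v axis p 1) $ i = det (M z) / det (A z)"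
      by (simp add: M_def)
    then show ?thesis
      by (simp add: matrix_vector_mul_component inner_axis divide_inverse)
  qed
  ultimately show ?thesis by (rule smooth_on_cong[OF S, rotated])
qed

section \<open>Tangent vectors in charts\<close>

lemma is_chartD:
  assumes "is_chart c"
  shows "p \<in> fst c \<Longrightarrow> chart_inv c (snd c p) = p"
    and "inj_on (snd c) (fst c)"
    and "open (snd c ` fst c)"
    and "open T \<Longrightarrow> open (snd c ` (fst c \<inter> T))"
proof -
  have h: "homeomorphism (fst c) (snd c ` fst c) (snd c) (chart_inv c)" and o: "open (snd c ` fst c)"
    using assms by (auto simp: is_chart_def)
  show i: "chart_inv c (snd c p) = p" if "p \<in> fst c" for p
    using h that by (auto simp: homeomorphism_def)
  show "inj_on (snd c) (fst c)"
    by (metis i inj_onI)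
  show "open (snd c ` fst c)" by (fact o)
  show "open (snd c ` (fst c \<inter> T))" if "open T"
    using homeomorphism_imp_open_map[OF h, of "fst c \<inter> T"] that o
    by (metis openin_open_Int openin_open_trans)
qed

text \<open>The cocycle condition of the Jacobians. It makes it possible to prescribe the components of a
  tangent vector in one chart.\<close>
lemma transition_chain:
  assumes A: "smooth_atlas A" and c: "c \<in> A" "d \<in> A" "e \<in> A"
    and p: "p \<in> fst c" "p \<in> fst d" "p \<in> fst e"
  shows "frechet_derivative (transition c e) (at (snd c p)) y =
         frechet_derivative (transition d e) (at (snd d p))
           (frechet_derivative (transition c d) (at (snd c p)) y)"
proof -
  have ch: "is_chart c" "is_chart d" "is_chart e" using A c by (auto simp: smooth_atlas_def)
  have sm: "smooth_on (snd c ` (fst c \<inter> fst d)) (transition c d)"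
    "smooth_on (snd d ` (fst d \<inter> fst e)) (transition d e)"
    using A c by (auto simp: smooth_atlas_def)
  have d1: "(transition c d has_derivative frechet_derivative (transition c d) (at (snd c p))) (at (snd c p))"
    using smooth_on_imp_differentiable[OF sm(1)] p frechet_derivative_works by blast
  have d2: "(transition d e has_derivative frechet_derivative (transition d e) (at (snd d p))) (at (snd d p))"
    using smooth_on_imp_differentiable[OF sm(2)] p frechet_derivative_works by blast
  have tp: "transition c d (snd c p) = snd d p"
    by (simp add: transition_def is_chartD(1)[OF ch(1)] p)
  let ?T = "snd c ` (fst c \<inter> fst d)"
  have o: "open ?T"
    using is_chartD(4)[OF ch(1)] ch(2) by (simp add: is_chart_def)
  have "((transition d e \<circ> transition c d) has_derivative
      (frechet_derivative (transition d e) (at (snd d p)) \<circ> frechet_derivative (transition c d) (at (snd c p))))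
      (at (snd c p))"
    using diff_chain_at[OF d1] d2 tp by simp
  then have "(transition c e has_derivative
      (frechet_derivative (transition d e) (at (snd d p)) \<circ> frechet_derivative (transition c d) (at (snd c p))))
      (at (snd c p))"
  proof (rule has_derivative_transform_within_open[OF _ o])
    show "snd c p \<in> ?T" using p by blast
    show "(transition d e \<circ> transition c d) u = transition c e u" if "u \<in> ?T" for u
      using that by (auto simp: transition_def is_chartD(1)[OF ch(1)] is_chartD(1)[OF ch(2)])
  qed
  from frechet_derivative_at[OF this] show ?thesis by (metis comp_apply)
qed

lemma transition_self:
  assumes A: "smooth_atlas A" and c: "c \<in> A" and p: "p \<in> fst c"
  shows "frechet_derivative (transition c c) (at (snd c p)) y = y"
proof -
  have ch: "is_chart c" using A c by (auto simp: smooth_atlas_def)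
  have "((\<lambda>u. u) has_derivative (\<lambda>u. u)) (at (snd c p))" by (rule has_derivative_ident)
  then have "(transition c c has_derivative (\<lambda>u. u)) (at (snd c p))"
  proof (rule has_derivative_transform_within_open[OF _ is_chartD(3)[OF ch]])
    show "snd c p \<in> snd c ` fst c" using p by blast
    show "u = transition c c u" if "u \<in> snd c ` fst c" for u
      using that by (auto simp: transition_def is_chartD(1)[OF ch])
  qed
  from frechet_derivative_at[OF this] show ?thesis by metis
qed

lemma tangent_vector_with_components:
  assumes A: "smooth_atlas A" and c: "c \<in> A" and p: "p \<in> fst c"
  obtains v where "v \<in> tangent_space A p" "v c = y"
proof
  let ?v = "\<lambda>d. if d \<in> A \<and> p \<in> fst d
    then frechet_derivative (transition c d) (at (snd c p)) y else 0"
  show "?v \<in> tangent_space A p"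
    unfolding tangent_space_def mem_Collect_eq
  proof (intro conjI ballI impI allI)
    fix d e assume "d \<in> A" "e \<in> A" "p \<in> fst d" "p \<in> fst e"
    then show "?v e = frechet_derivative (transition d e) (at (snd d p)) (?v d)"
      using transition_chain[OF A c \<open>d \<in> A\<close> \<open>e \<in> A\<close> p, of y] by simp
  next
    fix d assume "\<not> (d \<in> A \<and> p \<in> fst d)"
    then show "?v d = 0" by (simp only: if_False)
  qed
  show "?v c = y" using transition_self[OF A c p] c p by simp
qed

lemma tangent_vector_eqI:
  assumes "c \<in> A" "p \<in> fst c" "v \<in> tangent_space A p" "w \<in> tangent_space A p" "v c = w c"
  shows "v = w"
proof
  fix d
  have "u d = (if d \<in> A \<and> p \<in> fst d
      then frechet_derivative (transition c d) (at (snd c p)) (u c) else 0)"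
    if "u \<in> tangent_space A p" for u
  proof (cases "d \<in> A \<and> p \<in> fst d")
    case True
    then show ?thesis using that assms(1,2) unfolding tangent_space_def by (simp only: simp_thms if_True) blast
  next
    case False
    then show ?thesis using that unfolding tangent_space_def by (simp only: simp_thms if_False) blast
  qed
  from this[OF assms(3)] this[OF assms(4)] show "v d = w d"
    using assms(5) by simp
qed

lemma linear_transition_derivative:
  assumes A: "smooth_atlas A" and "c \<in> A" "d \<in> A" "p \<in> fst c" "p \<in> fst d"
  shows "linear (frechet_derivative (transition c d) (at (snd c p)))"
proof -
  have "smooth_on (snd c ` (fst c \<inter> fst d)) (transition c d)"
    using assms by (auto simp: smooth_atlas_def)
  then have "transition c d differentiable (at (snd c p))"
    by (rule smooth_on_imp_differentiable) (use assms in blast)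
  then show ?thesis by (rule linear_frechet_derivative)
qed

lemma zero_in_tangent_space:
  assumes "smooth_atlas A"
  shows "(\<lambda>_. 0) \<in> tangent_space A p"
  unfolding tangent_space_def mem_Collect_eq
proof (intro conjI ballI impI allI)
  fix c d assume "c \<in> A" "d \<in> A" "p \<in> fst c" "p \<in> fst d"
  then show "0 = frechet_derivative (transition c d) (at (snd c p)) 0"
    using linear_0[OF linear_transition_derivative[OF assms]] by simp
qed (rule refl)

lemma scaleR_in_tangent_space:
  assumes A: "smooth_atlas A" and v: "v \<in> tangent_space A p"
  shows "(\<lambda>c. r *\<^sub>R v c) \<in> tangent_space A p"
  unfolding tangent_space_def mem_Collect_eq
proof (intro conjI ballI impI allI)
  fix c d assume c: "c \<in> A" "d \<in> A" "p \<in> fst c" "p \<in> fst d"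
  then have "v d = frechet_derivative (transition c d) (at (snd c p)) (v c)"
    using v unfolding tangent_space_def by blast
  then show "r *\<^sub>R v d = frechet_derivative (transition c d) (at (snd c p)) (r *\<^sub>R v c)"
    by (simp only: linear_cmul[OF linear_transition_derivative[OF A c]])
next
  fix c assume "\<not> (c \<in> A \<and> p \<in> fst c)"
  then have "v c = 0" using v unfolding tangent_space_def by blast
  then show "r *\<^sub>R v c = 0" by simp
qed

lemma induced_inv_induced:
  assumes A: "smooth_atlas A" and c: "c \<in> A" and t: "t \<in> tangent_bundle A" "fst t \<in> fst c"
  shows "induced_inv A c (induced c t) = t"
  unfolding induced_inv_def
proof (rule inv_into_f_f)
  have ch: "is_chart c" using A c by (auto simp: smooth_atlas_def)
  show "inj_on (induced c) {t \<in> tangent_bundle A. fst t \<in> fst c}"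
  proof (rule inj_onI)
    fix s t assume *: "s \<in> {t \<in> tangent_bundle A. fst t \<in> fst c}"
      "t \<in> {t \<in> tangent_bundle A. fst t \<in> fst c}" "induced c s = induced c t"
    then have "fst s = fst t"
      using is_chartD(2)[OF ch] by (auto simp: induced_def split_beta inj_on_def)
    moreover have "snd s = snd t"
      using * tangent_vector_eqI[OF c] calculation
      by (auto simp: induced_def tangent_bundle_def split_beta)
    ultimately show "s = t" by (simp add: prod_eq_iff)
  qed
qed (use t in simp)

text \<open>The components in one chart determine all others linearly, so they vanish only for the zero
  vector; conversely any components in one chart extend to a tangent vector.\<close>
lemma induced_slit_bundle:
  fixes A :: "('a::topological_space, 'm::finite) chart set"
  assumes A: "smooth_atlas A" and c: "c \<in> A"
  shows "induced c ` {t \<in> slit_bundle A. fst t \<in> fst c} = (snd c ` fst c) \<times> (UNIV - {0})"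
proof
  show "induced c ` {t \<in> slit_bundle A. fst t \<in> fst c} \<subseteq> (snd c ` fst c) \<times> (UNIV - {0})"
    using tangent_vector_eqI[OF c _ _ zero_in_tangent_space[OF A]]
    by (fastforce simp: induced_def slit_bundle_def)
next
  show "(snd c ` fst c) \<times> (UNIV - {0}) \<subseteq> induced c ` {t \<in> slit_bundle A. fst t \<in> fst c}"
  proof
    fix z :: "(real^'m) \<times> (real^'m)"
    assume "z \<in> (snd c ` fst c) \<times> (UNIV - {0})"
    then obtain p y where p: "p \<in> fst c" and y: "y \<noteq> 0" and z: "z = (snd c p, y)" by auto
    obtain v where "v \<in> tangent_space A p" "v c = y"
      using tangent_vector_with_components[OF A c p] .
    then show "z \<in> induced c ` {t \<in> slit_bundle A. fst t \<in> fst c}"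
      using p y z by (intro image_eqI[of _ _ "(p, v)"]) (auto simp: induced_def slit_bundle_def)
  qed
qed

section \<open>Partial derivatives in the induced coordinates\<close>

text \<open>The derivative operators are limits along coordinate lines and mean nothing where the limit does
  not exist. For differentiable functions they are values of the total derivative, which makes
  them preserve smoothness.\<close>
lemma has_derivative_dy:
  assumes "V differentiable (at (x, y))"
  shows "((\<lambda>t. V (x, y + t *\<^sub>R axis i 1)) has_real_derivative dy i V (x, y)) (at 0)"
    and "dy i V (x, y) = frechet_derivative V (at (x, y)) (0, axis i 1)"
proof -
  have "((\<lambda>t. V (x, y + t *\<^sub>R axis i 1)) has_derivative
      (\<lambda>t. frechet_derivative V (at (x, y)) (0, t *\<^sub>R axis i 1))) (at 0)"
  proof (rule has_derivative_compose[of "\<lambda>t. (x, y + t *\<^sub>R axis i 1)"])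
    show "((\<lambda>t. (x, y + t *\<^sub>R axis i 1)) has_derivative (\<lambda>t. (0, t *\<^sub>R axis i 1))) (at 0)"
      by (auto intro!: derivative_eq_intros)
    show "(V has_derivative frechet_derivative V (at (x, y)))
        (at ((x, y + 0 *\<^sub>R axis i 1)))"
      using assms by (simp add: frechet_derivative_works)
  qed
  moreover have "frechet_derivative V (at (x, y)) (0, t *\<^sub>R axis i 1) =
      t * frechet_derivative V (at (x, y)) (0, axis i 1)" for t
    using linear_cmul[OF linear_frechet_derivative[OF assms], of t "(0, axis i 1)"]
    by simp
  ultimately have *: "((\<lambda>t. V (x, y + t *\<^sub>R axis i 1)) has_real_derivative
      frechet_derivative V (at (x, y)) (0, axis i 1)) (at 0)"
    by (simp add: has_field_derivative_def mult.commute[of _ "frechet_derivative V _ _"])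
  then show "dy i V (x, y) = frechet_derivative V (at (x, y)) (0, axis i 1)"
    by (simp add: dy_def DERIV_imp_deriv)
  with * show "((\<lambda>t. V (x, y + t *\<^sub>R axis i 1)) has_real_derivative dy i V (x, y)) (at 0)"
    by simp
qed

lemma has_derivative_dx:
  assumes "V differentiable (at (x, y))"
  shows "((\<lambda>t. V (x + t *\<^sub>R axis i 1, y)) has_real_derivative dx i V (x, y)) (at 0)"
    and "dx i V (x, y) = frechet_derivative V (at (x, y)) (axis i 1, 0)"
proof -
  have "((\<lambda>t. V (x + t *\<^sub>R axis i 1, y)) has_derivative
      (\<lambda>t. frechet_derivative V (at (x, y)) (t *\<^sub>R axis i 1, 0))) (at 0)"
  proof (rule has_derivative_compose[of "\<lambda>t. (x + t *\<^sub>R axis i 1, y)"])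
    show "((\<lambda>t. (x + t *\<^sub>R axis i 1, y)) has_derivative (\<lambda>t. (t *\<^sub>R axis i 1, 0))) (at 0)"
      by (auto intro!: derivative_eq_intros)
    show "(V has_derivative frechet_derivative V (at (x, y)))
        (at ((x + 0 *\<^sub>R axis i 1, y)))"
      using assms by (simp add: frechet_derivative_works)
  qed
  moreover have "frechet_derivative V (at (x, y)) (t *\<^sub>R axis i 1, 0) =
      t * frechet_derivative V (at (x, y)) (axis i 1, 0)" for t
    using linear_cmul[OF linear_frechet_derivative[OF assms], of t "(axis i 1, 0)"]
    by simp
  ultimately have *: "((\<lambda>t. V (x + t *\<^sub>R axis i 1, y)) has_real_derivative
      frechet_derivative V (at (x, y)) (axis i 1, 0)) (at 0)"
    by (simp add: has_field_derivative_def mult.commute[of _ "frechet_derivative V _ _"])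
  then show "dx i V (x, y) = frechet_derivative V (at (x, y)) (axis i 1, 0)"
    by (simp add: dx_def DERIV_imp_deriv)
  with * show "((\<lambda>t. V (x + t *\<^sub>R axis i 1, y)) has_real_derivative dx i V (x, y)) (at 0)"
    by simp
qed

lemma smooth_on_dy:
  assumes "open S" "smooth_on S V" shows "smooth_on S (dy i V)"
  by (rule smooth_on_cong[OF assms(1) _ smooth_on_frechet_derivative[OF assms(2), of "(0, axis i 1)"]])
    (auto simp: has_derivative_dy(2) smooth_on_imp_differentiable[OF assms(2)])

lemma smooth_on_dx:
  assumes "open S" "smooth_on S V" shows "smooth_on S (dx i V)"
  by (rule smooth_on_cong[OF assms(1) _ smooth_on_frechet_derivative[OF assms(2), of "(axis i 1, 0)"]])
    (auto simp: has_derivative_dx(2) smooth_on_imp_differentiable[OF assms(2)])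

lemma smooth_on_snd_component: "open S \<Longrightarrow> smooth_on S (\<lambda>z. snd z $ i)"
  by (intro smooth_on_linear bounded_linear_compose[OF bounded_linear_vec_nth bounded_linear_snd])

lemma open_slit: "open U \<Longrightarrow> open (U \<times> (UNIV - {0 :: real^'k}))"
  by (intro open_Times open_Diff) auto

text \<open>A coordinate expression is usually known only near the point in question. To differentiate it
  in a fibre direction, agreement at the same base point and nearby fibre coordinates is enough.\<close>
lemma dy_eqI:
  assumes "open Y" "y \<in> Y" "\<And>y'. y' \<in> Y \<Longrightarrow> G (x, y') = G' (x, y')"
    and "((\<lambda>t. G' (x, y + t *\<^sub>R axis i 1)) has_real_derivative D) (at 0)"
  shows "dy i G (x, y) = D"
proof -
  have "open ((\<lambda>t. y + t *\<^sub>R axis i 1) -` Y)"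
    by (intro open_vimage assms(1) continuous_intros)
  then have "((\<lambda>t. G (x, y + t *\<^sub>R axis i 1)) has_real_derivative D) (at 0)"
    using has_field_derivative_transform_within_open[OF assms(4), of "(\<lambda>t. y + t *\<^sub>R axis i 1) -` Y"]
      assms(2,3) by simp
  then show ?thesis by (simp add: dy_def DERIV_imp_deriv)
qed

lemma dx_eqI:
  assumes "open X" "x \<in> X" "\<And>x'. x' \<in> X \<Longrightarrow> G (x', y) = G' (x', y)"
    and "((\<lambda>t. G' (x + t *\<^sub>R axis i 1, y)) has_real_derivative D) (at 0)"
  shows "dx i G (x, y) = D"
proof -
  have "open ((\<lambda>t. x + t *\<^sub>R axis i 1) -` X)"
    by (intro open_vimage assms(1) continuous_intros)
  then have "((\<lambda>t. G (x + t *\<^sub>R axis i 1, y)) has_real_derivative D) (at 0)"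
    using has_field_derivative_transform_within_open[OF assms(4), of "(\<lambda>t. x + t *\<^sub>R axis i 1) -` X"]
      assms(2,3) by simp
  then show ?thesis by (simp add: dx_def DERIV_imp_deriv)
qed

lemma dy_const: "dy i (\<lambda>_. c) = (\<lambda>_. 0)"
  by (auto simp: dy_def)

lemma dy_linear:
  fixes c :: "'k::finite \<Rightarrow> real"
  shows "dy i (\<lambda>z. \<Sum>q\<in>UNIV. c q * snd z $ q) = (\<lambda>_. c i)"
proof (intro ext, clarify)
  fix x y :: "real^'k"
  have "((\<lambda>t. \<Sum>q\<in>UNIV. c q * (y + t *\<^sub>R axis i 1) $ q) has_real_derivative
      (\<Sum>q\<in>UNIV. c q * axis i 1 $ q)) (at 0)"
  proof (rule DERIV_sum)
    fix q
    have "((\<lambda>t. (y + t *\<^sub>R axis i 1) $ q) has_real_derivative axis i 1 $ q) (at 0)"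
      by (auto intro!: derivative_eq_intros)
    then show "((\<lambda>t. c q * (y + t *\<^sub>R axis i 1) $ q) has_real_derivative c q * axis i 1 $ q) (at 0)"
      by (rule DERIV_cmult)
  qed
  then have "dy i (\<lambda>z. \<Sum>q\<in>UNIV. c q * snd z $ q) (x, y) = (\<Sum>q\<in>UNIV. c q * axis i 1 $ q)"
    by (simp add: dy_def DERIV_imp_deriv)
  then show "dy i (\<lambda>z. \<Sum>q\<in>UNIV. c q * snd z $ q) (x, y) = c i"
    by (simp add: axis_def if_distrib[of "\<lambda>u. _ * u"] cong: if_cong)
qed

section \<open>Homogeneity and positivity of a Finsler energy\<close>

text \<open>The coordinate expression of a Finsler metric over one chart with image \<open>U\<close>.\<close>
locale coordinate_finsler =
  fixes U :: "(real^'k::finite) set" and \<Phi> :: "(real^'k) \<times> (real^'k) \<Rightarrow> real"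
  assumes open_U: "open U"
    and smooth: "smooth_on (U \<times> (UNIV - {0})) \<Phi>"
    and homogeneous: "x \<in> U \<Longrightarrow> y \<noteq> 0 \<Longrightarrow> 0 < r \<Longrightarrow> \<Phi> (x, r *\<^sub>R y) = r * \<Phi> (x, y)"
    and positive_definite: "x \<in> U \<Longrightarrow> y \<noteq> 0 \<Longrightarrow> w \<noteq> 0 \<Longrightarrow> 0 < w \<bullet> (fundamental_tensor \<Phi> (x, y) *v w)"
begin

abbreviation "S \<equiv> U \<times> (UNIV - {0 :: real^'k})"

abbreviation "E \<equiv> (\<lambda>z. (\<Phi> z)\<^sup>2)"

lemma open_S: "open S"
  by (rule open_slit[OF open_U])

lemma smooth_E: "smooth_on S E"
  by (rule smooth_on_power2[OF open_S smooth])

lemma smooth_fundamental_tensor: "smooth_on S (\<lambda>z. fundamental_tensor \<Phi> z $ i $ j)"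
  unfolding fundamental_tensor_def
  by (simp del: times_divide_eq_left)
    (intro smooth_on_mult smooth_on_const smooth_on_dy smooth_E open_S)

lemma invertible_fundamental_tensor:
  assumes "z \<in> S" shows "invertible (fundamental_tensor \<Phi> z)"
proof -
  have "w = 0" if "fundamental_tensor \<Phi> z *v w = 0" for w
    using positive_definite[of "fst z" "snd z" w] that assms by force
  then show ?thesis
    by (simp add: invertible_left_inverse matrix_left_invertible_ker)
qed

lemma smooth_inverse_fundamental_tensor:
  "smooth_on S (\<lambda>z. matrix_inv (fundamental_tensor \<Phi> z) $ i $ j)"
  by (intro smooth_on_matrix_inv open_S smooth_fundamental_tensor invertible_fundamental_tensor)

lemma smooth_spray: "smooth_on S (spray \<Phi> i)"
  unfolding spray_def[abs_def]
  by (intro smooth_on_mult smooth_on_const smooth_on_sum smooth_on_diff smooth_on_dy smooth_on_dx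
      smooth_on_snd_component smooth_inverse_fundamental_tensor smooth_E open_S)

text \<open>Euler's relation for a function of degree \<open>2\<close>: differentiate
  \<open>E (x, (1 + t) y) = (1 + t)\<^sup>2 E (x, y)\<close> at \<open>t = 0\<close>.\<close>
lemma Euler_energy:
  assumes "x \<in> U" "y \<noteq> 0"
  shows "(\<Sum>i\<in>UNIV. y $ i * dy i E (x, y)) = 2 * E (x, y)"
proof -
  have d: "E differentiable (at (x, y))"
    using smooth_on_imp_differentiable[OF smooth_E] assms by simp
  let ?D = "frechet_derivative E (at (x, y))"
  have lin: "linear ?D" by (rule linear_frechet_derivative[OF d])
  have "((\<lambda>t. E (x, y + t *\<^sub>R y)) has_derivative (\<lambda>t. ?D (0, t *\<^sub>R y))) (at 0)"
  proof (rule has_derivative_compose[of "\<lambda>t. (x, y + t *\<^sub>R y)"])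
    show "((\<lambda>t. (x, y + t *\<^sub>R y)) has_derivative (\<lambda>t. (0, t *\<^sub>R y))) (at 0)"
      by (auto intro!: derivative_eq_intros)
    show "(E has_derivative ?D) (at (x, y + 0 *\<^sub>R y))"
      using d by (simp add: frechet_derivative_works)
  qed
  moreover have "?D (0, t *\<^sub>R y) = ?D (0, y) * t" for t
    using linear_cmul[OF lin, of t "(0, y)"] by simp
  ultimately have 1: "((\<lambda>t. E (x, y + t *\<^sub>R y)) has_real_derivative ?D (0, y)) (at 0)"
    by (simp add: has_field_derivative_def)
  have "((\<lambda>t. (1 + t)\<^sup>2 * E (x, y)) has_real_derivative 2 * E (x, y)) (at 0)"
    by (auto intro!: derivative_eq_intros)
  then have 2: "((\<lambda>t. E (x, y + t *\<^sub>R y)) has_real_derivative 2 * E (x, y)) (at 0)"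
  proof (rule has_field_derivative_transform_within_open[where S = "{-1<..}"])
    fix t :: real assume "t \<in> {-1<..}"
    then have "\<Phi> (x, (1 + t) *\<^sub>R y) = (1 + t) * \<Phi> (x, y)"
      using homogeneous assms by simp
    then show "(1 + t)\<^sup>2 * E (x, y) = E (x, y + t *\<^sub>R y)"
      by (simp add: scaleR_add_left power_mult_distrib)
  qed auto
  have "(0, y) = (\<Sum>i\<in>UNIV. y $ i *\<^sub>R (0 :: real^'k, axis i 1 :: real^'k))"
    by (simp add: prod_eq_iff fst_sum snd_sum basis_expansion[of y, unfolded scalar_mult_eq_scaleR])
  then have "?D (0, y) = (\<Sum>i\<in>UNIV. y $ i * ?D (0, axis i 1))"
    by (simp only: linear_sum[OF lin] linear_cmul[OF lin]) simp
  then show ?thesis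
    using DERIV_unique[OF 1 2] by (simp add: has_derivative_dy(2)[OF d])
qed

text \<open>Differentiating Euler's relation once more gives \<open>g(y, y) = E\<close>, and \<open>g\<close> is positive definite.\<close>
lemma energy_pos:
  assumes x: "x \<in> U" and y: "y \<noteq> 0"
  shows "0 < E (x, y)"
proof -
  \<comment> \<open>Euler's relation, differentiated in the direction \<open>j\<close> by the product rule\<close>
  have second: "(\<Sum>i\<in>UNIV. y $ i * dy j (dy i E) (x, y)) = dy j E (x, y)" for j
  proof -
    have d: "dy i E differentiable (at (x, y))" for i
      using smooth_on_imp_differentiable[OF smooth_on_dy[OF open_S smooth_E]] x y by simp
    let ?G = "\<lambda>z. \<Sum>i\<in>UNIV. snd z $ i * dy i E z"
    have "((\<lambda>t. ?G (x, y + t *\<^sub>R axis j 1)) has_real_derivative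
        (\<Sum>i\<in>UNIV. axis j 1 $ i * dy i E (x, y) + dy j (dy i E) (x, y) * y $ i)) (at 0)"
    proof (simp only: snd_conv, rule DERIV_sum)
      fix i
      have c: "((\<lambda>t. (y + t *\<^sub>R axis j 1) $ i) has_real_derivative axis j 1 $ i) (at 0)"
        by (auto intro!: derivative_eq_intros)
      show "((\<lambda>t. (y + t *\<^sub>R axis j 1) $ i * dy i E (x, y + t *\<^sub>R axis j 1)) has_real_derivative
          axis j 1 $ i * dy i E (x, y) + dy j (dy i E) (x, y) * y $ i) (at 0)"
        using DERIV_mult[OF c has_derivative_dy(1)[OF d]] by simp
    qed
    moreover have "((\<lambda>t. ?G (x, y + t *\<^sub>R axis j 1)) has_real_derivative 2 * dy j E (x, y)) (at 0)"
    proof -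
      have "((\<lambda>t. 2 * E (x, y + t *\<^sub>R axis j 1)) has_real_derivative 2 * dy j E (x, y)) (at 0)"
        using has_derivative_dy(1)[OF smooth_on_imp_differentiable[OF smooth_E]] x y
        by (intro DERIV_cmult) auto
      moreover have "open ((\<lambda>t. y + t *\<^sub>R axis j 1) -` (UNIV - {0}))"
        by (intro open_vimage open_Diff continuous_intros) auto
      ultimately show ?thesis
      proof (rule has_field_derivative_transform_within_open)
        fix t assume "t \<in> (\<lambda>t. y + t *\<^sub>R axis j 1) -` (UNIV - {0})"
        then show "2 * E (x, y + t *\<^sub>R axis j 1) = ?G (x, y + t *\<^sub>R axis j 1)"
          using Euler_energy[OF x, of "y + t *\<^sub>R axis j 1"] by simp
      qed (use y in simp)
    qed
    ultimately have "2 * dy j E (x, y) =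
        (\<Sum>i\<in>UNIV. axis j 1 $ i * dy i E (x, y) + dy j (dy i E) (x, y) * y $ i)"
      by (rule DERIV_unique[rotated])
    also have "\<dots> = (\<Sum>i\<in>UNIV. axis j 1 $ i * dy i E (x, y)) + (\<Sum>i\<in>UNIV. y $ i * dy j (dy i E) (x, y))"
      by (simp add: sum.distrib mult.commute)
    also have "(\<Sum>i\<in>UNIV. axis j 1 $ i * dy i E (x, y)) = dy j E (x, y)"
      by (simp add: axis_def if_distrib[of "\<lambda>u. u * _"] cong: if_cong)
    finally show ?thesis by simp
  qed
  have "0 < y \<bullet> (fundamental_tensor \<Phi> (x, y) *v y)"
    by (rule positive_definite[OF x y y])
  also have "\<dots> = (\<Sum>i\<in>UNIV. \<Sum>j\<in>UNIV. 1/2 * (y $ j * (y $ i * dy j (dy i E) (x, y))))"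
    by (simp add: inner_vec_def matrix_vector_mult_def fundamental_tensor_def sum_distrib_left algebra_simps)
  also have "\<dots> = 1/2 * (\<Sum>j\<in>UNIV. y $ j * (\<Sum>i\<in>UNIV. y $ i * dy j (dy i E) (x, y)))"
    by (subst sum.swap) (simp add: sum_distrib_left)
  also have "\<dots> = E (x, y)"
    by (simp only: second Euler_energy[OF x y])
  finally show ?thesis .
qed

text \<open>A fibre derivative lowers the degree of homogeneity by one. In particular the fundamental tensor
  has degree \<open>0\<close>.\<close>
lemma dy_homogeneous:
  assumes G: "smooth_on S G" and hom: "\<And>y. y \<noteq> 0 \<Longrightarrow> G (x, r *\<^sub>R y) = c * G (x, y)"
    and r: "0 < r" and x: "x \<in> U" and y: "y \<noteq> 0"
  shows "dy i G (x, r *\<^sub>R y) = c / r * dy i G (x, y)"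
proof -
  have d: "G differentiable (at (x, r *\<^sub>R y))" "G differentiable (at (x, y))"
    using smooth_on_imp_differentiable[OF G] x y r by auto
  have "((\<lambda>t. G (x, r *\<^sub>R y + (r * t) *\<^sub>R axis i 1)) has_real_derivative dy i G (x, r *\<^sub>R y) * r) (at 0)"
    by (rule DERIV_chain2[where f = "\<lambda>u. G (x, r *\<^sub>R y + u *\<^sub>R axis i 1)"])
      (use has_derivative_dy(1)[OF d(1)] in \<open>auto intro!: derivative_eq_intros\<close>)
  moreover have "((\<lambda>t. G (x, r *\<^sub>R y + (r * t) *\<^sub>R axis i 1)) has_real_derivative c * dy i G (x, y)) (at 0)"
  proof (rule has_field_derivative_transform_within_open[OF DERIV_cmult[OF has_derivative_dy(1)[OF d(2)]]])
    show "open ((\<lambda>t. y + t *\<^sub>R axis i 1) -` (UNIV - {0}))"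
      by (intro open_vimage open_Diff continuous_intros) auto
    fix t assume "t \<in> (\<lambda>t. y + t *\<^sub>R axis i 1) -` (UNIV - {0})"
    then show "c * G (x, y + t *\<^sub>R axis i 1) = G (x, r *\<^sub>R y + (r * t) *\<^sub>R axis i 1)"
      using hom[of "y + t *\<^sub>R axis i 1"] by (simp add: scaleR_add_right)
  qed (use y in simp)
  ultimately have "dy i G (x, r *\<^sub>R y) * r = c * dy i G (x, y)"
    by (rule DERIV_unique)
  then show ?thesis using r by (simp add: field_simps)
qed

lemma energy_homogeneous:
  assumes "x \<in> U" "y \<noteq> 0" "0 < r"
  shows "E (x, r *\<^sub>R y) = r\<^sup>2 * E (x, y)"
  using homogeneous[OF assms] by (simp add: power_mult_distrib)

lemma fundamental_tensor_homogeneous: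
  assumes x: "x \<in> U" and y: "y \<noteq> 0" and r: "0 < r"
  shows "fundamental_tensor \<Phi> (x, r *\<^sub>R y) = fundamental_tensor \<Phi> (x, y)"
proof -
  have 1: "dy i E (x, r *\<^sub>R y) = r * dy i E (x, y)" if "y \<noteq> 0" for i y
    using dy_homogeneous[OF smooth_E energy_homogeneous[OF x _ r] r x that] r
    by (simp add: power2_eq_square)
  have "dy j (dy i E) (x, r *\<^sub>R y) = dy j (dy i E) (x, y)" for i j
    using dy_homogeneous[OF smooth_on_dy[OF open_S smooth_E] 1 r x y] r by simp
  then show ?thesis by (simp add: fundamental_tensor_def)
qed

end

section \<open>Functions that separate the two factors\<close>

lemma sum_UNIV_Plus:
  fixes f :: "'m::finite + 'n::finite \<Rightarrow> 'c::comm_monoid_add"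
  shows "(\<Sum>p\<in>UNIV. f p) = (\<Sum>a\<in>UNIV. f (Inl a)) + (\<Sum>b\<in>UNIV. f (Inr b))"
  using sum.Plus[of "UNIV :: 'm set" "UNIV :: 'n set" f] by (simp add: comp_def)

lemma join_simps [simp]:
  "left_part (join u w) = u" "right_part (join u w) = w"
  by (simp_all add: join_def left_part_def right_part_def vec_eq_iff)

lemma join_parts [simp]: "join (left_part u) (right_part u) = u"
  by (simp add: join_def left_part_def right_part_def vec_eq_iff split: sum.split)

lemma parts_along_axis:
  "left_part (u + t *\<^sub>R axis (Inl i) 1) = left_part u + t *\<^sub>R axis i 1"
  "left_part (u + t *\<^sub>R axis (Inr j) 1) = left_part u"
  "right_part (u + t *\<^sub>R axis (Inl i) 1) = right_part u"
  "right_part (u + t *\<^sub>R axis (Inr j) 1) = right_part u + t *\<^sub>R axis j 1"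
  by (simp_all add: left_part_def right_part_def vec_eq_iff axis_def)

lemma component_eq_part:
  "u $ Inl i = left_part u $ i" "u $ Inr j = right_part u $ j"
  by (simp_all add: left_part_def right_part_def)

lemma continuous_on_parts:
  "continuous_on X (left_part :: real^('m::finite + 'n::finite) \<Rightarrow> real^'m)"
  "continuous_on X (right_part :: real^('m::finite + 'n::finite) \<Rightarrow> real^'n)"
  unfolding left_part_def[abs_def] right_part_def[abs_def] by (intro continuous_intros)+

lemma open_parts:
  assumes "open V" "open W"
  shows "open {u :: real^('m::finite + 'n::finite). left_part u \<in> V \<and> right_part u \<in> W}"
proof -
  have "{u :: real^('m + 'n). left_part u \<in> V \<and> right_part u \<in> W} = left_part -` V \<inter> right_part -` W"
    by auto
  then show ?thesis
    using assms by (auto intro!: open_Int open_vimage continuous_on_parts)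
qed

text \<open>At a fixed base point all quantities met below have the form \<open>A k + B l\<close>, where \<open>A\<close> and \<open>B\<close>
  depend on the fibre coordinate of one factor and \<open>k\<close> and \<open>l\<close> on that of the other. Derivatives in the
  first factor act on \<open>A\<close> and \<open>B\<close> only. The form is preserved, so the rule can be iterated.\<close>
lemma dy_left_split:
  fixes G :: "(real^('m::finite + 'n::finite)) \<times> (real^('m + 'n)) \<Rightarrow> real"
  assumes G: "\<And>y. left_part y \<noteq> 0 \<Longrightarrow> right_part y \<noteq> 0 \<Longrightarrow>
      G (x, y) = A (left_part x, left_part y) * k (right_part y) + B (left_part x, left_part y) * l (right_part y)"
    and smooth: "smooth_on (U \<times> (UNIV - {0})) A" "smooth_on (U \<times> (UNIV - {0})) B"
    and x: "left_part x \<in> U" and y: "left_part y \<noteq> 0" "right_part y \<noteq> 0"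
  shows "dy (Inl i) G (x, y) =
      dy i A (left_part x, left_part y) * k (right_part y) + dy i B (left_part x, left_part y) * l (right_part y)"
proof (rule dy_eqI)
  show "open {y :: real^('m + 'n). left_part y \<in> - {0} \<and> right_part y \<in> - {0}}"
    by (intro open_parts) auto
  show "G (x, y') = (\<lambda>(x, y). A (left_part x, left_part y) * k (right_part y) +
      B (left_part x, left_part y) * l (right_part y)) (x, y')"
    if "y' \<in> {y. left_part y \<in> - {0} \<and> right_part y \<in> - {0}}" for y'
    using that G by simp
  have d: "A differentiable (at (left_part x, left_part y))" "B differentiable (at (left_part x, left_part y))"
    using smooth x y by (auto intro!: smooth_on_imp_differentiable)
  show "((\<lambda>t. (\<lambda>(x, y). A (left_part x, left_part y) * k (right_part y) +
      B (left_part x, left_part y) * l (right_part y)) (x, y + t *\<^sub>R axis (Inl i) 1)) has_real_derivative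
      dy i A (left_part x, left_part y) * k (right_part y) + dy i B (left_part x, left_part y) * l (right_part y)) (at 0)"
    unfolding prod.case parts_along_axis
    by (intro DERIV_add DERIV_cmult_right has_derivative_dy d)
qed (use y in simp)

lemma dy_right_split:
  fixes G :: "(real^('m::finite + 'n::finite)) \<times> (real^('m + 'n)) \<Rightarrow> real"
  assumes G: "\<And>y. left_part y \<noteq> 0 \<Longrightarrow> right_part y \<noteq> 0 \<Longrightarrow>
      G (x, y) = A (right_part x, right_part y) * k (left_part y) + B (right_part x, right_part y) * l (left_part y)"
    and smooth: "smooth_on (U \<times> (UNIV - {0})) A" "smooth_on (U \<times> (UNIV - {0})) B"
    and x: "right_part x \<in> U" and y: "left_part y \<noteq> 0" "right_part y \<noteq> 0"
  shows "dy (Inr i) G (x, y) =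
      dy i A (right_part x, right_part y) * k (left_part y) + dy i B (right_part x, right_part y) * l (left_part y)"
proof (rule dy_eqI)
  show "open {y :: real^('m + 'n). left_part y \<in> - {0} \<and> right_part y \<in> - {0}}"
    by (intro open_parts) auto
  show "G (x, y') = (\<lambda>(x, y). A (right_part x, right_part y) * k (left_part y) +
      B (right_part x, right_part y) * l (left_part y)) (x, y')"
    if "y' \<in> {y. left_part y \<in> - {0} \<and> right_part y \<in> - {0}}" for y'
    using that G by simp
  have d: "A differentiable (at (right_part x, right_part y))" "B differentiable (at (right_part x, right_part y))"
    using smooth x y by (auto intro!: smooth_on_imp_differentiable)
  show "((\<lambda>t. (\<lambda>(x, y). A (right_part x, right_part y) * k (left_part y) +
      B (right_part x, right_part y) * l (left_part y)) (x, y + t *\<^sub>R axis (Inr i) 1)) has_real_derivative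
      dy i A (right_part x, right_part y) * k (left_part y) + dy i B (right_part x, right_part y) * l (left_part y)) (at 0)"
    unfolding prod.case parts_along_axis
    by (intro DERIV_add DERIV_cmult_right has_derivative_dy d)
qed (use y in simp)

lemma dy_left_split3:
  fixes G :: "(real^('m::finite + 'n::finite)) \<times> (real^('m + 'n)) \<Rightarrow> real"
  assumes G: "\<And>y. left_part y \<noteq> 0 \<Longrightarrow> right_part y \<noteq> 0 \<Longrightarrow>
      G (x, y) = A (left_part x, left_part y) * k (right_part y) + B (left_part x, left_part y) * l (right_part y)"
    and U: "open U" and smooth: "smooth_on (U \<times> (UNIV - {0})) A" "smooth_on (U \<times> (UNIV - {0})) B"
    and x: "left_part x \<in> U" and y: "left_part y \<noteq> 0" "right_part y \<noteq> 0"
  shows "dy (Inl i3) (dy (Inl i2) (dy (Inl i1) G)) (x, y) =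
      dy i3 (dy i2 (dy i1 A)) (left_part x, left_part y) * k (right_part y) +
      dy i3 (dy i2 (dy i1 B)) (left_part x, left_part y) * l (right_part y)"
  by (intro dy_left_split[where U = U] G smooth_on_dy open_slit U smooth x y)

lemma dy_right_split3:
  fixes G :: "(real^('m::finite + 'n::finite)) \<times> (real^('m + 'n)) \<Rightarrow> real"
  assumes G: "\<And>y. left_part y \<noteq> 0 \<Longrightarrow> right_part y \<noteq> 0 \<Longrightarrow>
      G (x, y) = A (right_part x, right_part y) * k (left_part y) + B (right_part x, right_part y) * l (left_part y)"
    and U: "open U" and smooth: "smooth_on (U \<times> (UNIV - {0})) A" "smooth_on (U \<times> (UNIV - {0})) B"
    and x: "right_part x \<in> U" and y: "left_part y \<noteq> 0" "right_part y \<noteq> 0"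
  shows "dy (Inr i3) (dy (Inr i2) (dy (Inr i1) G)) (x, y) =
      dy i3 (dy i2 (dy i1 A)) (right_part x, right_part y) * k (left_part y) +
      dy i3 (dy i2 (dy i1 B)) (right_part x, right_part y) * l (left_part y)"
  by (intro dy_right_split[where U = U] G smooth_on_dy open_slit U smooth x y)

section \<open>Fundamental tensor of a twisted product\<close>

text \<open>The coordinate expression \<open>F\<close> is described only where both fibre coordinates are nonzero, since
  it need not be differentiable where one of them vanishes.\<close>
locale coordinate_twisted_product =
  M1: coordinate_finsler U1 \<Phi>1 + M2: coordinate_finsler U2 \<Phi>2
  for U1 :: "(real^'m::finite) set" and \<Phi>1 and U2 :: "(real^'n::finite) set" and \<Phi>2 +
  fixes \<phi> :: "(real^'m) \<times> (real^'n) \<Rightarrow> real"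
    and F :: "(real^('m + 'n)) \<times> (real^('m + 'n)) \<Rightarrow> real"
  assumes smooth_warp: "smooth_on (U1 \<times> U2) \<phi>"
    and warp_pos: "u \<in> U1 \<Longrightarrow> w \<in> U2 \<Longrightarrow> 0 < \<phi> (u, w)"
    and F_eq: "left_part x \<in> U1 \<Longrightarrow> right_part x \<in> U2 \<Longrightarrow> left_part y \<noteq> 0 \<Longrightarrow> right_part y \<noteq> 0 \<Longrightarrow>
      F (x, y) = sqrt ((\<Phi>1 (left_part x, left_part y))\<^sup>2 +
        (\<phi> (left_part x, right_part x))\<^sup>2 * (\<Phi>2 (right_part x, right_part y))\<^sup>2)"
begin

abbreviation E :: "(real^('m + 'n)) \<times> (real^('m + 'n)) \<Rightarrow> real" where "E \<equiv> (\<lambda>z. (F z)\<^sup>2)"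

abbreviation h :: "real^('m + 'n) \<Rightarrow> real" where "h \<equiv> (\<lambda>x. (\<phi> (left_part x, right_part x))\<^sup>2)"

abbreviation Dh :: "'m + 'n \<Rightarrow> real^('m + 'n) \<Rightarrow> real"
  where "Dh \<alpha> x \<equiv> deriv (\<lambda>t. h (x + t *\<^sub>R axis \<alpha> 1)) 0"

context
  fixes x :: "real^('m + 'n)"
  assumes x: "left_part x \<in> U1" "right_part x \<in> U2"
begin

lemma h_pos: "0 < h x"
  using warp_pos[OF x] by simp

lemma energy_split:
  assumes "left_part x' \<in> U1" "right_part x' \<in> U2" "left_part y \<noteq> 0" "right_part y \<noteq> 0"
  shows "E (x', y) = M1.E (left_part x', left_part y) + h x' * M2.E (right_part x', right_part y)"
  using F_eq[OF assms] by simp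

lemma h_has_derivative: "((\<lambda>t. h (x + t *\<^sub>R axis \<alpha> 1)) has_real_derivative Dh \<alpha> x) (at 0)"
proof -
  obtain a b where ab: "left_part (x + t *\<^sub>R axis \<alpha> 1) = left_part x + t *\<^sub>R a \<and>
      right_part (x + t *\<^sub>R axis \<alpha> 1) = right_part x + t *\<^sub>R b" for t
    by (cases \<alpha>) (use parts_along_axis[of x] in \<open>metis add.right_neutral scaleR_zero_right\<close>)+
  have "\<phi> differentiable (at (left_part x, right_part x))"
    using smooth_on_imp_differentiable[OF smooth_warp] x by simp
  then obtain D where D: "(\<phi> has_derivative D) (at (left_part x + 0 *\<^sub>R a, right_part x + 0 *\<^sub>R b))"
    by (auto simp: differentiable_def)
  have "((\<lambda>t. \<phi> (left_part x + t *\<^sub>R a, right_part x + t *\<^sub>R b)) has_derivative (\<lambda>t. D (t *\<^sub>R a, t *\<^sub>R b))) (at 0)"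
    by (rule has_derivative_compose[of "\<lambda>t. (left_part x + t *\<^sub>R a, right_part x + t *\<^sub>R b)", OF _ D])
      (auto intro!: derivative_eq_intros)
  then have "(\<lambda>t. h (x + t *\<^sub>R axis \<alpha> 1)) differentiable (at 0)"
    unfolding ab[THEN conjunct1] ab[THEN conjunct2]
    by (intro differentiable_power differentiableI)
  then show ?thesis
    by (simp add: field_differentiable_derivI real_differentiable_def DERIV_deriv_iff_real_differentiable)
qed

context
  fixes y :: "real^('m + 'n)"
  assumes y: "left_part y \<noteq> 0" "right_part y \<noteq> 0"
begin

lemma dx_energy:
  "dx (Inl i) E (x, y) = dx i M1.E (left_part x, left_part y) + Dh (Inl i) x * M2.E (right_part x, right_part y)"
  "dx (Inr j) E (x, y) = h x * dx j M2.E (right_part x, right_part y) + Dh (Inr j) x * M2.E (right_part x, right_part y)"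
proof -
  have o: "open {u :: real^('m + 'n). left_part u \<in> U1 \<and> right_part u \<in> U2}"
    by (intro open_parts M1.open_U M2.open_U)
  have d: "M1.E differentiable (at (left_part x, left_part y))" "M2.E differentiable (at (right_part x, right_part y))"
    using smooth_on_imp_differentiable[OF M1.smooth_E] smooth_on_imp_differentiable[OF M2.smooth_E] x y
    by auto
  have eq: "E (x', y) = (\<lambda>(x', y). M1.E (left_part x', left_part y) + h x' * M2.E (right_part x', right_part y)) (x', y)"
    if "x' \<in> {u. left_part u \<in> U1 \<and> right_part u \<in> U2}" for x'
    using energy_split[OF _ _ y] that by simp
  show "dx (Inl i) E (x, y) = dx i M1.E (left_part x, left_part y) + Dh (Inl i) x * M2.E (right_part x, right_part y)"
  proof (rule dx_eqI[where G' = "\<lambda>(x', y). M1.E (left_part x', left_part y) + h x' * M2.E (right_part x', right_part y)",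
        OF o _ eq])
    show "((\<lambda>t. (\<lambda>(x', y). M1.E (left_part x', left_part y) + h x' * M2.E (right_part x', right_part y))
        (x + t *\<^sub>R axis (Inl i) 1, y)) has_real_derivative
        dx i M1.E (left_part x, left_part y) + Dh (Inl i) x * M2.E (right_part x, right_part y)) (at 0)"
      using DERIV_add[OF has_derivative_dx(1)[OF d(1), of i] DERIV_cmult_right[OF h_has_derivative[of "Inl i"]]]
      by (simp add: parts_along_axis)
  qed (use x in simp)
  show "dx (Inr j) E (x, y) = h x * dx j M2.E (right_part x, right_part y) + Dh (Inr j) x * M2.E (right_part x, right_part y)"
  proof (rule dx_eqI[where G' = "\<lambda>(x', y). M1.E (left_part x', left_part y) + h x' * M2.E (right_part x', right_part y)",
        OF o _ eq])
    show "((\<lambda>t. (\<lambda>(x', y). M1.E (left_part x', left_part y) + h x' * M2.E (right_part x', right_part y))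
        (x + t *\<^sub>R axis (Inr j) 1, y)) has_real_derivative
        h x * dx j M2.E (right_part x, right_part y) + Dh (Inr j) x * M2.E (right_part x, right_part y)) (at 0)"
      using DERIV_add[OF DERIV_const[of "M1.E (left_part x, left_part y)"]
          DERIV_mult[OF h_has_derivative[of "Inr j"] has_derivative_dx(1)[OF d(2), of j]]]
      by (simp add: parts_along_axis algebra_simps)
  qed (use x in simp)
qed

lemma dy_energy:
  "dy (Inl i) E (x, y) = dy i M1.E (left_part x, left_part y)"
  "dy (Inr j) E (x, y) = h x * dy j M2.E (right_part x, right_part y)"
proof -
  show "dy (Inl i) E (x, y) = dy i M1.E (left_part x, left_part y)"
    by (subst dy_left_split[where U = U1 and A = M1.E and k = "\<lambda>_. 1" and B = "\<lambda>_. 1"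
          and l = "\<lambda>w. h x * M2.E (right_part x, w)"])
      (use x y in \<open>auto simp: energy_split dy_const intro: M1.smooth_E smooth_on_const M1.open_S\<close>)
  show "dy (Inr j) E (x, y) = h x * dy j M2.E (right_part x, right_part y)"
    by (subst dy_right_split[where U = U2 and A = M2.E and k = "\<lambda>_. h x" and B = "\<lambda>_. 1"
          and l = "\<lambda>w. M1.E (left_part x, w)"])
      (use x y in \<open>auto simp: energy_split dy_const intro: M2.smooth_E smooth_on_const M2.open_S\<close>)
qed

end

lemmas smooth_energy_derivatives =
  smooth_on_dy[OF M1.open_S M1.smooth_E] smooth_on_dy[OF M2.open_S M2.smooth_E]
  smooth_on_dx[OF M1.open_S M1.smooth_E] smooth_on_dx[OF M2.open_S M2.smooth_E]

lemma dy_function_of_left: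
  assumes "left_part y \<noteq> 0" "right_part y \<noteq> 0"
    and "\<And>y. left_part y \<noteq> 0 \<Longrightarrow> right_part y \<noteq> 0 \<Longrightarrow> G (x, y) = c * A (left_part x, left_part y)"
    and "smooth_on M1.S A"
  shows "dy (Inl i) G (x, y) = c * dy i A (left_part x, left_part y)" "dy (Inr j) G (x, y) = 0"
proof -
  show "dy (Inl i) G (x, y) = c * dy i A (left_part x, left_part y)"
    by (subst dy_left_split[where U = U1 and A = A and k = "\<lambda>_. c" and B = "\<lambda>_. 0" and l = "\<lambda>_. 0"])
      (use assms x in \<open>auto intro: smooth_on_const M1.open_S\<close>)
  show "dy (Inr j) G (x, y) = 0"
    by (subst dy_right_split[where U = U2 and A = "\<lambda>_. 1" and k = "\<lambda>w. c * A (left_part x, w)"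
          and B = "\<lambda>_. 0" and l = "\<lambda>_. 0"])
      (use assms x in \<open>auto simp: dy_const intro: smooth_on_const M2.open_S\<close>)
qed

lemma dy_function_of_right:
  assumes "left_part y \<noteq> 0" "right_part y \<noteq> 0"
    and "\<And>y. left_part y \<noteq> 0 \<Longrightarrow> right_part y \<noteq> 0 \<Longrightarrow> G (x, y) = c * A (right_part x, right_part y)"
    and "smooth_on M2.S A"
  shows "dy (Inl i) G (x, y) = 0" "dy (Inr j) G (x, y) = c * dy j A (right_part x, right_part y)"
proof -
  show "dy (Inl i) G (x, y) = 0"
    by (subst dy_left_split[where U = U1 and A = "\<lambda>_. 1" and k = "\<lambda>w. c * A (right_part x, w)"
          and B = "\<lambda>_. 0" and l = "\<lambda>_. 0"])
      (use assms x in \<open>auto simp: dy_const intro: smooth_on_const M1.open_S\<close>)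
  show "dy (Inr j) G (x, y) = c * dy j A (right_part x, right_part y)"
    by (subst dy_right_split[where U = U2 and A = A and k = "\<lambda>_. c" and B = "\<lambda>_. 0" and l = "\<lambda>_. 0"])
      (use assms x in \<open>auto intro: smooth_on_const M2.open_S\<close>)
qed

context
  fixes y :: "real^('m + 'n)"
  assumes y: "left_part y \<noteq> 0" "right_part y \<noteq> 0"
begin

lemma fundamental_tensor_twisted:
  "fundamental_tensor F (x, y) $ Inl i $ Inl j = fundamental_tensor \<Phi>1 (left_part x, left_part y) $ i $ j"
  "fundamental_tensor F (x, y) $ Inl i $ Inr b = 0"
  "fundamental_tensor F (x, y) $ Inr a $ Inl j = 0"
  "fundamental_tensor F (x, y) $ Inr a $ Inr b = h x * fundamental_tensor \<Phi>2 (right_part x, right_part y) $ a $ b"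
proof -
  have l: "dy (Inl i) E (x, y') = 1 * dy i M1.E (left_part x, left_part y')"
    if "left_part y' \<noteq> 0" "right_part y' \<noteq> 0" for y' i using dy_energy(1)[OF that] by simp
  note L = dy_function_of_left[OF y l smooth_energy_derivatives(1)]
    and R = dy_function_of_right[OF y dy_energy(2) smooth_energy_derivatives(2)]
  show "fundamental_tensor F (x, y) $ Inl i $ Inl j = fundamental_tensor \<Phi>1 (left_part x, left_part y) $ i $ j"
    "fundamental_tensor F (x, y) $ Inl i $ Inr b = 0"
    "fundamental_tensor F (x, y) $ Inr a $ Inl j = 0"
    "fundamental_tensor F (x, y) $ Inr a $ Inr b = h x * fundamental_tensor \<Phi>2 (right_part x, right_part y) $ a $ b"
    by (simp_all add: fundamental_tensor_def L R)
qed

end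

end

end

section \<open>A square root that is not a polynomial\<close>

text \<open>The square of \<open>a + b s\<^sup>2\<close> cannot be \<open>k\<^sup>2 (A + B s\<^sup>2)\<close> with \<open>k \<noteq> 0\<close> and \<open>B > 0\<close>: the coefficient of
  \<open>s\<^sup>4\<close> forces \<open>b = 0\<close>, and then that of \<open>s\<^sup>2\<close> forces \<open>k\<^sup>2 B = 0\<close>. Three values of \<open>s\<close> determine the
  coefficients.\<close>
lemma quadratic_plus_sqrt:
  fixes A B a b k :: real
  assumes "0 < A" "0 < B" and eq: "\<And>s. 0 < s \<Longrightarrow> a + b * s\<^sup>2 + k * sqrt (A + B * s\<^sup>2) = 0"
  shows "k = 0"
proof -
  have sq: "(a + b * s\<^sup>2)\<^sup>2 = k\<^sup>2 * (A + B * s\<^sup>2)" if "0 < s" for s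
  proof -
    have "a + b * s\<^sup>2 = - (k * sqrt (A + B * s\<^sup>2))" using eq[OF that] by simp
    then show ?thesis using assms(1,2) by (simp add: power_mult_distrib)
  qed
  have s: "(a + b)\<^sup>2 = k\<^sup>2 * (A + B)" "(a + b * 4)\<^sup>2 = k\<^sup>2 * (A + B * 4)"
    "(a + b * 9)\<^sup>2 = k\<^sup>2 * (A + B * 9)"
    using sq[of 1] sq[of 2] sq[of 3] by simp_all
  have "b\<^sup>2 = 0" using s by algebra
  moreover have "2 * a * b = k\<^sup>2 * B" using s by algebra
  ultimately show "k = 0" using assms(2) by simp
qed

text \<open>Here the coefficient of \<open>s\<close> forces \<open>a b = 0\<close>, so one of \<open>a\<^sup>2 = k\<^sup>2 B\<close> and \<open>b\<^sup>2 = k\<^sup>2 A\<close>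
  vanishes.\<close>
lemma linear_plus_sqrt:
  fixes A B a b k :: real
  assumes "0 < A" "0 < B" and eq: "\<And>s. 0 < s \<Longrightarrow> a + b * s + k * sqrt (A * s\<^sup>2 + B) = 0"
  shows "k = 0"
proof -
  have sq: "(a + b * s)\<^sup>2 = k\<^sup>2 * (A * s\<^sup>2 + B)" if "0 < s" for s
  proof -
    have "a + b * s = - (k * sqrt (A * s\<^sup>2 + B))" using eq[OF that] by simp
    then show ?thesis using assms(1,2) by (simp add: power_mult_distrib add_nonneg_nonneg)
  qed
  have s: "(a + b)\<^sup>2 = k\<^sup>2 * (A + B)" "(a + b * 2)\<^sup>2 = k\<^sup>2 * (A * 4 + B)"
    "(a + b * 3)\<^sup>2 = k\<^sup>2 * (A * 9 + B)"
    using sq[of 1] sq[of 2] sq[of 3] by simp_all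
  have "b\<^sup>2 = k\<^sup>2 * A" using s by algebra
  moreover have "a * b = 0" using s by algebra
  moreover have "a\<^sup>2 = k\<^sup>2 * B" using s by algebra
  ultimately show "k = 0" using assms(1,2) by auto
qed

section \<open>Spray and curvature of a twisted product\<close>

context coordinate_twisted_product
begin

abbreviation "g1 \<equiv> fundamental_tensor \<Phi>1"
abbreviation "g2 \<equiv> fundamental_tensor \<Phi>2"

text \<open>The coefficient of \<open>F2\<^sup>2\<close> in the spray coefficients of the first factor.\<close>
definition left_spray_warp :: "real^('m + 'n) \<Rightarrow> 'm \<Rightarrow> (real^'m) \<times> (real^'m) \<Rightarrow> real" where
  "left_spray_warp x a z = (\<Sum>p\<in>UNIV. matrix_inv (g1 z) $ a $ p * (- 1/4 * Dh (Inl p) x))"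

text \<open>The vertical gradient of \<open>F2\<^sup>2\<close>, which is \<open>2 y\<close> by Euler's relation.\<close>
definition energy_gradient :: "'n \<Rightarrow> (real^'n) \<times> (real^'n) \<Rightarrow> real" where
  "energy_gradient a z = (\<Sum>c\<in>UNIV. matrix_inv (g2 z) $ a $ c * dy c M2.E z)"

text \<open>The part of the spray coefficients of the second factor that is independent of the fibre
  coordinate of the first.\<close>
definition right_spray_base :: "real^('m + 'n) \<Rightarrow> 'n \<Rightarrow> (real^'n) \<times> (real^'n) \<Rightarrow> real" where
  "right_spray_base x a z = spray \<Phi>2 a z + 1 / (4 * h x) * (energy_gradient a z * (\<Sum>b\<in>UNIV. Dh (Inr b) x * snd z $ b)
     - (\<Sum>c\<in>UNIV. matrix_inv (g2 z) $ a $ c * Dh (Inr c) x * M2.E z))"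

lemma smooth_left_spray_warp: "smooth_on M1.S (left_spray_warp x a)"
  unfolding left_spray_warp_def[abs_def]
  by (intro smooth_on_sum smooth_on_mult smooth_on_const M1.open_S M1.smooth_inverse_fundamental_tensor)

lemma smooth_energy_gradient: "smooth_on M2.S (energy_gradient a)"
  unfolding energy_gradient_def[abs_def]
  by (intro smooth_on_sum smooth_on_mult smooth_on_dy M2.smooth_E M2.open_S M2.smooth_inverse_fundamental_tensor)

lemma smooth_right_spray_base: "smooth_on M2.S (right_spray_base x a)"
  unfolding right_spray_base_def[abs_def]
  by (intro smooth_on_add smooth_on_diff smooth_on_sum smooth_on_mult smooth_on_const smooth_energy_gradient
      smooth_on_snd_component M2.smooth_E M2.smooth_spray M2.open_S M2.smooth_inverse_fundamental_tensor)

context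
  fixes x :: "real^('m + 'n)"
  assumes x: "left_part x \<in> U1" "right_part x \<in> U2"
begin

context
  fixes y :: "real^('m + 'n)"
  assumes y: "left_part y \<noteq> 0" "right_part y \<noteq> 0"
begin

lemma inverse_fundamental_tensor_twisted:
  "matrix_inv (fundamental_tensor F (x, y)) $ Inl i $ Inl j = matrix_inv (g1 (left_part x, left_part y)) $ i $ j"
  "matrix_inv (fundamental_tensor F (x, y)) $ Inl i $ Inr b = 0"
  "matrix_inv (fundamental_tensor F (x, y)) $ Inr a $ Inl j = 0"
  "matrix_inv (fundamental_tensor F (x, y)) $ Inr a $ Inr b = matrix_inv (g2 (right_part x, right_part y)) $ a $ b / h x"
proof -
  let ?z1 = "(left_part x, left_part y)" and ?z2 = "(right_part x, right_part y)"
  \<comment> \<open>the block diagonal candidate for the inverse\<close>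
  define K :: "real^('m + 'n)^('m + 'n)" where "K = (\<chi> \<alpha> \<beta>. case \<alpha> of
      Inl i \<Rightarrow> (case \<beta> of Inl j \<Rightarrow> matrix_inv (g1 ?z1) $ i $ j | Inr b \<Rightarrow> 0)
    | Inr a \<Rightarrow> (case \<beta> of Inl j \<Rightarrow> 0 | Inr b \<Rightarrow> matrix_inv (g2 ?z2) $ a $ b / h x))"
  have 1: "(\<Sum>k\<in>UNIV. g1 ?z1 $ i $ k * matrix_inv (g1 ?z1) $ k $ j) = (if i = j then 1 else 0)" for i j
    using matrix_inv_right[OF M1.invertible_fundamental_tensor[of ?z1]] x y
    by (simp add: vec_eq_iff matrix_mult_component mat_def)
  have 2: "(\<Sum>k\<in>UNIV. g2 ?z2 $ i $ k * matrix_inv (g2 ?z2) $ k $ j) = (if i = j then 1 else 0)" for i j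
    using matrix_inv_right[OF M2.invertible_fundamental_tensor[of ?z2]] x y
    by (simp add: vec_eq_iff matrix_mult_component mat_def)
  have "(fundamental_tensor F (x, y) ** K) $ \<alpha> $ \<beta> = mat 1 $ \<alpha> $ \<beta>" for \<alpha> \<beta>
    using h_pos[OF x]
    by (cases \<alpha>; cases \<beta>)
      (simp_all add: matrix_mult_component sum_UNIV_Plus fundamental_tensor_twisted[OF x y] K_def mat_def 1 2)
  then have "matrix_inv (fundamental_tensor F (x, y)) = K"
    by (intro matrix_inv_eqI) (simp add: vec_eq_iff)
  then show "matrix_inv (fundamental_tensor F (x, y)) $ Inl i $ Inl j = matrix_inv (g1 ?z1) $ i $ j"
    "matrix_inv (fundamental_tensor F (x, y)) $ Inl i $ Inr b = 0"
    "matrix_inv (fundamental_tensor F (x, y)) $ Inr a $ Inl j = 0"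
    "matrix_inv (fundamental_tensor F (x, y)) $ Inr a $ Inr b = matrix_inv (g2 ?z2) $ a $ b / h x"
    by (simp_all add: K_def)
qed

lemma dy_dx_energy:
  "dy (Inl p) (dx (Inl q) E) (x, y) = dy p (dx q M1.E) (left_part x, left_part y)"
  "dy (Inl p) (dx (Inr b) E) (x, y) = 0"
  "dy (Inr c) (dx (Inl q) E) (x, y) = Dh (Inl q) x * dy c M2.E (right_part x, right_part y)"
  "dy (Inr c) (dx (Inr b) E) (x, y) = h x * dy c (dx b M2.E) (right_part x, right_part y)
     + Dh (Inr b) x * dy c M2.E (right_part x, right_part y)"
proof -
  show "dy (Inl p) (dx (Inl q) E) (x, y) = dy p (dx q M1.E) (left_part x, left_part y)"
    by (subst dy_left_split[where U = U1 and A = "dx q M1.E" and k = "\<lambda>_. 1" and B = "\<lambda>_. 1"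
          and l = "\<lambda>w. Dh (Inl q) x * M2.E (right_part x, w)"])
      (use x y in \<open>auto simp: dx_energy dy_const intro: smooth_energy_derivatives smooth_on_const M1.open_S\<close>)
  show "dy (Inl p) (dx (Inr b) E) (x, y) = 0"
    by (subst dy_left_split[where U = U1 and A = "\<lambda>_. 1" and B = "\<lambda>_. 0" and l = "\<lambda>_. 0" and
          k = "\<lambda>w. h x * dx b M2.E (right_part x, w) + Dh (Inr b) x * M2.E (right_part x, w)"])
      (use x y in \<open>auto simp: dx_energy dy_const intro: smooth_on_const M1.open_S\<close>)
  show "dy (Inr c) (dx (Inl q) E) (x, y) = Dh (Inl q) x * dy c M2.E (right_part x, right_part y)"
    by (subst dy_right_split[where U = U2 and A = M2.E and k = "\<lambda>_. Dh (Inl q) x" and B = "\<lambda>_. 1"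
          and l = "\<lambda>w. dx q M1.E (left_part x, w)"])
      (use x y in \<open>auto simp: dx_energy dy_const intro: M2.smooth_E smooth_on_const M2.open_S\<close>)
  show "dy (Inr c) (dx (Inr b) E) (x, y) = h x * dy c (dx b M2.E) (right_part x, right_part y)
     + Dh (Inr b) x * dy c M2.E (right_part x, right_part y)"
    by (subst dy_right_split[where U = U2 and A = "dx b M2.E" and k = "\<lambda>_. h x" and B = M2.E
          and l = "\<lambda>_. Dh (Inr b) x"])
      (use x y in \<open>auto simp: dx_energy intro: M2.smooth_E smooth_energy_derivatives\<close>)
qed

lemma spray_left:
  "spray F (Inl a) (x, y) = spray \<Phi>1 a (left_part x, left_part y)
     + left_spray_warp x a (left_part x, left_part y) * M2.E (right_part x, right_part y)"
  unfolding spray_def left_spray_warp_def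
  by (simp add: sum_UNIV_Plus inverse_fundamental_tensor_twisted dy_dx_energy dx_energy[OF x y]
      component_eq_part[of y] sum_distrib_left sum_distrib_right sum.distrib sum_subtractf sum_negf algebra_simps)

lemma spray_right:
  "spray F (Inr a) (x, y) = right_spray_base x a (right_part x, right_part y)
     + energy_gradient a (right_part x, right_part y) * (1 / (4 * h x) * (\<Sum>q\<in>UNIV. Dh (Inl q) x * left_part y $ q))"
proof -
  let ?z2 = "(right_part x, right_part y)"
  let ?H = "h x"
  let ?i = "\<lambda>c. matrix_inv (g2 ?z2) $ a $ c"
  \<comment> \<open>\<open>L\<close> and \<open>R\<close> are the derivatives of \<open>f\<^sup>2\<close> along the two parts of \<open>y\<close>; \<open>s\<close> is four times the
    spray of the second factor with its index lowered\<close>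
  define L where "L = (\<Sum>q\<in>UNIV. Dh (Inl q) x * left_part y $ q)"
  define R where "R = (\<Sum>b\<in>UNIV. Dh (Inr b) x * right_part y $ b)"
  define s where "s c = (\<Sum>b\<in>UNIV. dy c (dx b M2.E) ?z2 * right_part y $ b) - dx c M2.E ?z2" for c
  have H: "?H \<noteq> 0" using h_pos[OF x] by simp
  have lower: "(\<Sum>q\<in>UNIV. dy (Inr c) (dx q E) (x, y) * y $ q) - dx (Inr c) E (x, y)
      = ?H * s c + dy c M2.E ?z2 * (L + R) - Dh (Inr c) x * M2.E ?z2" for c
    by (simp add: sum_UNIV_Plus dy_dx_energy dx_energy[OF x y] component_eq_part[of y] s_def L_def R_def
        sum_distrib_left sum_distrib_right sum.distrib algebra_simps)
  have "spray F (Inr a) (x, y) = 1/4 * (\<Sum>c\<in>UNIV. ?i c / ?H *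
      (?H * s c + dy c M2.E ?z2 * (L + R) - Dh (Inr c) x * M2.E ?z2))"
    unfolding spray_def snd_conv
    by (subst sum_UNIV_Plus) (simp only: lower inverse_fundamental_tensor_twisted, simp)
  also have "\<dots> = 1/4 * (\<Sum>c\<in>UNIV. ?i c * s c + 1 / ?H * (?i c * dy c M2.E ?z2) * (L + R)
      - 1 / ?H * (?i c * Dh (Inr c) x * M2.E ?z2))"
    using H by (intro arg_cong[of _ _ "(*) (1/4)"] sum.cong) (simp_all add: field_simps)
  also have "\<dots> = 1/4 * (\<Sum>c\<in>UNIV. ?i c * s c) + 1 / (4 * ?H) * (energy_gradient a ?z2 * (L + R))
      - 1 / (4 * ?H) * (\<Sum>c\<in>UNIV. ?i c * Dh (Inr c) x * M2.E ?z2)"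
  proof -
    have "(\<Sum>c\<in>UNIV. ?i c * s c + 1 / ?H * (?i c * dy c M2.E ?z2) * (L + R)
      - 1 / ?H * (?i c * Dh (Inr c) x * M2.E ?z2)) = (\<Sum>c\<in>UNIV. ?i c * s c) + 1 / ?H * energy_gradient a ?z2 * (L + R)
      - 1 / ?H * (\<Sum>c\<in>UNIV. ?i c * Dh (Inr c) x * M2.E ?z2)"
      unfolding sum.distrib sum_subtractf energy_gradient_def sum_distrib_left sum_distrib_right by (rule refl)
    moreover have "1/4 * (u + 1 / ?H * v * w - 1 / ?H * t) = 1/4 * u + 1 / (4 * ?H) * (v * w) - 1 / (4 * ?H) * t"
      for u v w t :: real
      by (simp add: algebra_simps add_divide_distrib diff_divide_distrib)
    ultimately show ?thesis by (simp only:)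
  qed
  also have "1/4 * (\<Sum>c\<in>UNIV. ?i c * s c) = spray \<Phi>2 a ?z2"
    by (simp add: spray_def s_def)
  finally show ?thesis
    unfolding right_spray_base_def L_def[symmetric] snd_conv R_def[symmetric] by (simp add: algebra_simps)
qed

end

context
  fixes y :: "real^('m + 'n)"
  assumes y: "left_part y \<noteq> 0" "right_part y \<noteq> 0"
begin

lemma berwald_twisted_left:
  "berwald F (Inl a) (Inl i) (Inl j) (Inl k) (x, y) = berwald \<Phi>1 a i j k (left_part x, left_part y)
     + dy k (dy j (dy i (left_spray_warp x a))) (left_part x, left_part y) * M2.E (right_part x, right_part y)"
  "berwald F (Inr b) (Inl i) (Inl j) (Inl k) (x, y) = 0"
proof -
  show "berwald F (Inl a) (Inl i) (Inl j) (Inl k) (x, y) = berwald \<Phi>1 a i j k (left_part x, left_part y)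
     + dy k (dy j (dy i (left_spray_warp x a))) (left_part x, left_part y) * M2.E (right_part x, right_part y)"
    unfolding berwald_def
    by (subst dy_left_split3[where A = "spray \<Phi>1 a" and k = "\<lambda>_. 1" and B = "left_spray_warp x a"
          and l = "\<lambda>w. M2.E (right_part x, w)" and U = U1])
      (use spray_left x y in \<open>auto intro: M1.open_U M1.smooth_spray smooth_left_spray_warp\<close>)
  \<comment> \<open>affine in the fibre coordinate of the first factor\<close>
  show "berwald F (Inr b) (Inl i) (Inl j) (Inl k) (x, y) = 0"
    unfolding berwald_def
    by (subst dy_left_split3[where A = "\<lambda>_. 1" and k = "\<lambda>w. right_spray_base x b (right_part x, w)"
          and B = "\<lambda>z. \<Sum>q\<in>UNIV. Dh (Inl q) x * snd z $ q"
          and l = "\<lambda>w. energy_gradient b (right_part x, w) * (1 / (4 * h x))" and U = U1])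
      (use spray_right x y in \<open>auto simp: dy_linear dy_const
        intro!: M1.open_U M1.open_S smooth_on_sum smooth_on_mult smooth_on_const smooth_on_snd_component\<close>)
qed

lemma berwald_twisted_right:
  "berwald F (Inl a) (Inr i) (Inr j) (Inr k) (x, y) =
     dy k (dy j (dy i M2.E)) (right_part x, right_part y) * left_spray_warp x a (left_part x, left_part y)"
  "berwald F (Inr b) (Inr i) (Inr j) (Inr k) (x, y) =
     dy k (dy j (dy i (right_spray_base x b))) (right_part x, right_part y)
     + dy k (dy j (dy i (energy_gradient b))) (right_part x, right_part y)
       * (1 / (4 * h x) * (\<Sum>q\<in>UNIV. Dh (Inl q) x * left_part y $ q))"
proof -
  show "berwald F (Inl a) (Inr i) (Inr j) (Inr k) (x, y) =
     dy k (dy j (dy i M2.E)) (right_part x, right_part y) * left_spray_warp x a (left_part x, left_part y)"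
    unfolding berwald_def
    by (subst dy_right_split3[where A = "\<lambda>_. 1" and k = "\<lambda>w. spray \<Phi>1 a (left_part x, w)" and B = M2.E
          and l = "\<lambda>w. left_spray_warp x a (left_part x, w)" and U = U2])
      (use spray_left x y in \<open>auto simp: dy_const intro: M2.open_U M2.open_S M2.smooth_E smooth_on_const\<close>)
  show "berwald F (Inr b) (Inr i) (Inr j) (Inr k) (x, y) =
     dy k (dy j (dy i (right_spray_base x b))) (right_part x, right_part y)
     + dy k (dy j (dy i (energy_gradient b))) (right_part x, right_part y)
       * (1 / (4 * h x) * (\<Sum>q\<in>UNIV. Dh (Inl q) x * left_part y $ q))"
    unfolding berwald_def
    by (subst dy_right_split3[where A = "right_spray_base x b" and k = "\<lambda>_. 1" and B = "energy_gradient b"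
          and l = "\<lambda>w. 1 / (4 * h x) * (\<Sum>q\<in>UNIV. Dh (Inl q) x * w $ q)" and U = U2])
      (use spray_right x y in \<open>auto intro: M2.open_U smooth_right_spray_base smooth_energy_gradient\<close>)
qed

lemma cartan_twisted:
  "cartan F (Inl i) (Inl j) (Inl k) (x, y) = cartan \<Phi>1 i j k (left_part x, left_part y)"
  "cartan F (Inr a) (Inr b) (Inr c) (x, y) = h x * cartan \<Phi>2 a b c (right_part x, right_part y)"
  "cartan F (Inl i) (Inl j) (Inr c) (x, y) = 0"
  "cartan F (Inl i) (Inr b) \<gamma> (x, y) = 0"
  "cartan F (Inr a) (Inl j) \<gamma> (x, y) = 0"
  "cartan F (Inr a) (Inr b) (Inl k) (x, y) = 0"
proof -
  have g: "fundamental_tensor F (x, y') $ Inl i $ Inl j = 1 * g1 (left_part x, left_part y') $ i $ j"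
    "fundamental_tensor F (x, y') $ Inl i $ Inr b = 0"
    "fundamental_tensor F (x, y') $ Inr a $ Inl j = 0"
    if "left_part y' \<noteq> 0" "right_part y' \<noteq> 0" for y' i j a b
    using fundamental_tensor_twisted[OF x that] by simp_all
  have Z: "dy \<gamma> G (x, y) = 0"
    if "\<And>y. left_part y \<noteq> 0 \<Longrightarrow> right_part y \<noteq> 0 \<Longrightarrow> G (x, y) = 0" for G \<gamma>
  proof (rule dy_eqI[where G' = "\<lambda>_. 0" and Y = "{y. left_part y \<in> - {0} \<and> right_part y \<in> - {0}}"])
    show "open {y :: real^('m + 'n). left_part y \<in> - {0} \<and> right_part y \<in> - {0}}"
      by (intro open_parts) auto
  qed (use y that in auto)
  note L = dy_function_of_left[OF x y g(1) M1.smooth_fundamental_tensor]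
    and R = dy_function_of_right[OF x y fundamental_tensor_twisted(4)[OF x] M2.smooth_fundamental_tensor]
  show "cartan F (Inl i) (Inl j) (Inl k) (x, y) = cartan \<Phi>1 i j k (left_part x, left_part y)"
    "cartan F (Inr a) (Inr b) (Inr c) (x, y) = h x * cartan \<Phi>2 a b c (right_part x, right_part y)"
    "cartan F (Inl i) (Inl j) (Inr c) (x, y) = 0"
    "cartan F (Inr a) (Inr b) (Inl k) (x, y) = 0"
    by (simp_all add: cartan_def L R)
  show "cartan F (Inl i) (Inr b) \<gamma> (x, y) = 0" "cartan F (Inr a) (Inl j) \<gamma> (x, y) = 0"
    by (simp_all add: cartan_def Z g)
qed

lemma landsberg_blocks:
  "landsberg F \<alpha> \<beta> \<gamma> (x, y) = - 1/2 *
     ((\<Sum>l\<in>UNIV. \<Sum>m\<in>UNIV. g1 (left_part x, left_part y) $ l $ m * left_part y $ m * berwald F (Inl l) \<alpha> \<beta> \<gamma> (x, y))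
    + (\<Sum>l\<in>UNIV. \<Sum>m\<in>UNIV. h x * g2 (right_part x, right_part y) $ l $ m * right_part y $ m * berwald F (Inr l) \<alpha> \<beta> \<gamma> (x, y)))"
  by (simp add: landsberg_def sum_UNIV_Plus fundamental_tensor_twisted[OF x y] component_eq_part[of y])

end

text \<open>The spray coefficients of the second factor are affine in \<open>y1\<close>, so three derivatives kill them.
  Those of the first factor are affine in \<open>F2\<^sup>2\<close> with coefficients depending on \<open>y1\<close>.\<close>
lemma landsberg_left_affine:
  obtains a b where "\<And>y. left_part y = y1 \<Longrightarrow> y1 \<noteq> 0 \<Longrightarrow> right_part y \<noteq> 0 \<Longrightarrow>
    landsberg F (Inl i) (Inl j) (Inl k) (x, y) = a + b * M2.E (right_part x, right_part y)"
proof
  let ?z1 = "(left_part x, y1)"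
  let ?w = "\<lambda>l m. g1 ?z1 $ l $ m * y1 $ m"
  fix y :: "real^('m + 'n)" assume "left_part y = y1" "y1 \<noteq> 0" "right_part y \<noteq> 0"
  then show "landsberg F (Inl i) (Inl j) (Inl k) (x, y) =
      - 1/2 * (\<Sum>l\<in>UNIV. \<Sum>m\<in>UNIV. ?w l m * berwald \<Phi>1 l i j k ?z1)
      + (- 1/2 * (\<Sum>l\<in>UNIV. \<Sum>m\<in>UNIV. ?w l m * dy k (dy j (dy i (left_spray_warp x l))) ?z1))
        * M2.E (right_part x, right_part y)"
    by (simp add: landsberg_blocks berwald_twisted_left sum_distrib_left sum_distrib_right
        sum.distrib sum_negf algebra_simps)
qed

text \<open>The fundamental tensor of the first factor and its inverse have degree \<open>0\<close> in \<open>y1\<close>. So \<open>y1\<close> enters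
  only through the contraction with \<open>y\<close> and through the derivative of \<open>f\<^sup>2\<close> along \<open>y1\<close>. Both are of
  degree \<open>1\<close>, and they occur in different terms.\<close>
lemma landsberg_right_affine:
  obtains a b where "\<And>r y. left_part y = r *\<^sub>R y1 \<Longrightarrow> right_part y = y2 \<Longrightarrow> y1 \<noteq> 0 \<Longrightarrow> y2 \<noteq> 0 \<Longrightarrow> 0 < r \<Longrightarrow>
    landsberg F (Inr i) (Inr j) (Inr k) (x, y) = a + b * r"
proof
  let ?z1 = "(left_part x, y1)" and ?z2 = "(right_part x, y2)"
  let ?w = "\<lambda>l m. g1 ?z1 $ l $ m * y1 $ m * (dy k (dy j (dy i M2.E)) ?z2 * left_spray_warp x l ?z1)"
  let ?v = "\<lambda>l m. h x * g2 ?z2 $ l $ m * y2 $ m"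
  let ?c = "1 / (4 * h x) * (\<Sum>q\<in>UNIV. Dh (Inl q) x * y1 $ q)"
  fix r and y :: "real^('m + 'n)" assume y: "left_part y = r *\<^sub>R y1" "right_part y = y2" "y1 \<noteq> 0" "y2 \<noteq> 0" and r: "0 < r"
  \<comment> \<open>how \<open>y1\<close> enters: unscaled in \<open>g1\<close> and its inverse, linearly in the
    derivative of \<open>f\<^sup>2\<close>\<close>
  have g: "g1 (left_part x, r *\<^sub>R y1) = g1 ?z1"
    by (rule M1.fundamental_tensor_homogeneous[OF x(1) y(3) r])
  have B: "left_spray_warp x l (left_part x, r *\<^sub>R y1) = left_spray_warp x l ?z1" for l
    by (simp add: left_spray_warp_def g)
  have c: "1 / (4 * h x) * (\<Sum>q\<in>UNIV. Dh (Inl q) x * (r *\<^sub>R y1) $ q) = ?c * r"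
    by (simp add: sum_distrib_left sum_distrib_right algebra_simps)
  have lin: "- 1/2 * ((\<Sum>l\<in>UNIV. \<Sum>m\<in>UNIV. p l m * r) + (\<Sum>l\<in>UNIV. \<Sum>m\<in>UNIV. u l m + t l m * r)) =
      - 1/2 * (\<Sum>l\<in>UNIV. \<Sum>m\<in>UNIV. u l m)
      + (- 1/2 * ((\<Sum>l\<in>UNIV. \<Sum>m\<in>UNIV. p l m) + (\<Sum>l\<in>UNIV. \<Sum>m\<in>UNIV. t l m))) * r"
    for p :: "'m \<Rightarrow> 'm \<Rightarrow> real" and u t :: "'n \<Rightarrow> 'n \<Rightarrow> real"
    unfolding sum.distrib sum_distrib_right[symmetric] by (simp add: algebra_simps)
  have "landsberg F (Inr i) (Inr j) (Inr k) (x, y) = - 1/2 *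
     ((\<Sum>l\<in>UNIV. \<Sum>m\<in>UNIV. ?w l m * r)
    + (\<Sum>l\<in>UNIV. \<Sum>m\<in>UNIV. ?v l m * dy k (dy j (dy i (right_spray_base x l))) ?z2 + ?v l m * dy k (dy j (dy i (energy_gradient l))) ?z2 * ?c * r))"
  proof -
    have y': "left_part y \<noteq> 0" "right_part y \<noteq> 0" using y r by simp_all
    show ?thesis
      unfolding landsberg_blocks[OF y'] berwald_twisted_right[OF y'] y(1,2) g B c
      by (simp only: vector_scaleR_component real_scaleR_def distrib_left mult_ac)
  qed
  also have "\<dots> = - 1/2 * (\<Sum>l\<in>UNIV. \<Sum>m\<in>UNIV. ?v l m * dy k (dy j (dy i (right_spray_base x l))) ?z2)
      + (- 1/2 * ((\<Sum>l\<in>UNIV. \<Sum>m\<in>UNIV. ?w l m) + (\<Sum>l\<in>UNIV. \<Sum>m\<in>UNIV. ?v l m * dy k (dy j (dy i (energy_gradient l))) ?z2 * ?c))) * r"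
    by (simp only: lin)
  finally show "landsberg F (Inr i) (Inr j) (Inr k) (x, y) =
     - 1/2 * (\<Sum>l\<in>UNIV. \<Sum>m\<in>UNIV. ?v l m * dy k (dy j (dy i (right_spray_base x l))) ?z2)
      + (- 1/2 * ((\<Sum>l\<in>UNIV. \<Sum>m\<in>UNIV. ?w l m) + (\<Sum>l\<in>UNIV. \<Sum>m\<in>UNIV. ?v l m * dy k (dy j (dy i (energy_gradient l))) ?z2 * ?c))) * r" .
qed

text \<open>The number \<open>\<kappa>\<close> is the value of the isotropy function at the base point. It must not change
  when a fibre coordinate is rescaled, which is why the hypothesis ranges over all fibre coordinates
  at one base point.\<close>
lemma isotropic_imp_landsberg:
  assumes iso: "\<And>y. left_part y \<noteq> 0 \<Longrightarrow> right_part y \<noteq> 0 \<Longrightarrow>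
      landsberg F \<alpha> \<beta> \<gamma> (x, y) + \<kappa> * F (x, y) * cartan F \<alpha> \<beta> \<gamma> (x, y) = 0"
    and y: "left_part y \<noteq> 0" "right_part y \<noteq> 0"
  shows "landsberg F \<alpha> \<beta> \<gamma> (x, y) = 0"
proof -
  have pos: "0 < M1.E (left_part x, left_part y)" "0 < h x * M2.E (right_part x, right_part y)"
    using M1.energy_pos[OF x(1) y(1)] M2.energy_pos[OF x(2) y(2)] h_pos[OF x] by simp_all
  have "\<kappa> * cartan F \<alpha> \<beta> \<gamma> (x, y) = 0"
  proof -
    consider i j k where "\<alpha> = Inl i" "\<beta> = Inl j" "\<gamma> = Inl k"
      | i j k where "\<alpha> = Inr i" "\<beta> = Inr j" "\<gamma> = Inr k"
      | "cartan F \<alpha> \<beta> \<gamma> (x, y) = 0"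
      by (cases \<alpha>; cases \<beta>; cases \<gamma>) (auto simp: cartan_twisted[OF y])
    then show ?thesis
    proof cases
      case 1
      obtain a b where ab: "\<And>y'. left_part y' = left_part y \<Longrightarrow> left_part y \<noteq> 0 \<Longrightarrow> right_part y' \<noteq> 0 \<Longrightarrow>
          landsberg F \<alpha> \<beta> \<gamma> (x, y') = a + b * M2.E (right_part x, right_part y')"
        using landsberg_left_affine[of "left_part y" i j k] 1 by metis
      show ?thesis
      proof (rule quadratic_plus_sqrt[OF pos])
        fix s :: real assume s: "0 < s"
        let ?y = "join (left_part y) (s *\<^sub>R right_part y)"
        have y': "left_part ?y \<noteq> 0" "right_part ?y \<noteq> 0" using y s by simp_all
        have E2: "M2.E (right_part x, s *\<^sub>R right_part y) = s\<^sup>2 * M2.E (right_part x, right_part y)"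
          by (rule M2.energy_homogeneous[OF x(2) y(2) s])
        have "F (x, ?y) = sqrt (M1.E (left_part x, left_part y) + h x * M2.E (right_part x, right_part y) * s\<^sup>2)"
          using F_eq[OF x y'] by (simp add: E2 mult_ac)
        moreover have "cartan F \<alpha> \<beta> \<gamma> (x, ?y) = cartan F \<alpha> \<beta> \<gamma> (x, y)"
          using cartan_twisted(1)[OF y'] cartan_twisted(1)[OF y] 1 by simp
        moreover have "landsberg F \<alpha> \<beta> \<gamma> (x, ?y) = a + b * (s\<^sup>2 * M2.E (right_part x, right_part y))"
          using ab[of ?y] y y' by (simp add: E2)
        ultimately show "a + b * M2.E (right_part x, right_part y) * s\<^sup>2 + \<kappa> * cartan F \<alpha> \<beta> \<gamma> (x, y) *
            sqrt (M1.E (left_part x, left_part y) + h x * M2.E (right_part x, right_part y) * s\<^sup>2) = 0"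
          using iso[OF y'] by (simp add: mult_ac)
      qed
    next
      case 2
      obtain a b where ab: "\<And>r y'. left_part y' = r *\<^sub>R left_part y \<Longrightarrow> right_part y' = right_part y \<Longrightarrow>
          left_part y \<noteq> 0 \<Longrightarrow> right_part y \<noteq> 0 \<Longrightarrow> 0 < r \<Longrightarrow>
          landsberg F \<alpha> \<beta> \<gamma> (x, y') = a + b * r"
        using landsberg_right_affine[of "left_part y" "right_part y" i j k] 2 by metis
      show ?thesis
      proof (rule linear_plus_sqrt[OF pos])
        fix s :: real assume s: "0 < s"
        let ?y = "join (s *\<^sub>R left_part y) (right_part y)"
        have y': "left_part ?y \<noteq> 0" "right_part ?y \<noteq> 0" using y s by simp_all
        have "F (x, ?y) = sqrt (M1.E (left_part x, left_part y) * s\<^sup>2 + h x * M2.E (right_part x, right_part y))"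
          using F_eq[OF x y'] M1.energy_homogeneous[OF x(1) y(1) s] by (simp add: mult_ac)
        moreover have "cartan F \<alpha> \<beta> \<gamma> (x, ?y) = cartan F \<alpha> \<beta> \<gamma> (x, y)"
          using cartan_twisted(2)[OF y'] cartan_twisted(2)[OF y] 2 by simp
        moreover have "landsberg F \<alpha> \<beta> \<gamma> (x, ?y) = a + b * s"
          using ab[of ?y s] y s by simp
        ultimately show "a + b * s + \<kappa> * cartan F \<alpha> \<beta> \<gamma> (x, y) *
            sqrt (M1.E (left_part x, left_part y) * s\<^sup>2 + h x * M2.E (right_part x, right_part y)) = 0"
          using iso[OF y'] by (simp add: mult_ac)
      qed
    qed simp
  qed
  then show ?thesis
    using iso[OF y] by auto
qed

end

end

section \<open>From charts to coordinates\<close>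

text \<open>Moves a point of the coordinate domain to the slit tangent bundle, where the metrics and the
  curvature conditions live.\<close>
lemma slit_bundle_coordinates:
  fixes A :: "('a::topological_space, 'm::finite) chart set"
  assumes A: "smooth_atlas A" and c: "c \<in> A" and x: "x \<in> snd c ` fst c" and y: "y \<noteq> 0"
  obtains t where "t \<in> slit_bundle A" "fst t \<in> fst c" "induced c t = (x, y)"
    "induced_inv A c (x, y) = t" "chart_inv c x = fst t"
proof -
  have "(x, y) \<in> induced c ` {t \<in> slit_bundle A. fst t \<in> fst c}"
    unfolding induced_slit_bundle[OF A c] using x y by simp
  then obtain t where t: "t \<in> slit_bundle A" "fst t \<in> fst c" "induced c t = (x, y)" by auto
  moreover have "induced_inv A c (x, y) = t"
    using induced_inv_induced[OF A c, of t] t by (auto simp: slit_bundle_def tangent_bundle_def)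
  moreover have "chart_inv c x = fst t"
    using is_chartD(1)[of c "fst t"] t A c by (auto simp: smooth_atlas_def induced_def split_beta)
  ultimately show ?thesis by (rule that)
qed

lemma finsler_metric_coordinates:
  fixes A :: "('a::topological_space, 'm::finite) chart set"
  assumes A: "smooth_atlas A" and F: "finsler_metric A F" and c: "c \<in> A"
  shows "coordinate_finsler (snd c ` fst c) (F \<circ> induced_inv A c)"
proof
  show "open (snd c ` fst c)"
    using A c is_chartD(3)[of c] by (auto simp: smooth_atlas_def)
  show "smooth_on (snd c ` fst c \<times> (UNIV - {0})) (F \<circ> induced_inv A c)"
    using F c by (simp add: finsler_metric_def)
  show "0 < w \<bullet> (fundamental_tensor (F \<circ> induced_inv A c) (x, y) *v w)"
    if "x \<in> snd c ` fst c" "y \<noteq> 0" "w \<noteq> 0" for x y w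
    using F c that unfolding finsler_metric_def by blast
  show "(F \<circ> induced_inv A c) (x, r *\<^sub>R y) = r * (F \<circ> induced_inv A c) (x, y)"
    if x: "x \<in> snd c ` fst c" and y: "y \<noteq> 0" and r: "0 < r" for x y r
  proof -
    obtain p v where t: "(p, v) \<in> slit_bundle A" "p \<in> fst c" "induced c (p, v) = (x, y)"
      "induced_inv A c (x, y) = (p, v)"
      using slit_bundle_coordinates[OF A c x y] by (metis fst_conv surj_pair)
    have v: "v \<in> tangent_space A p" using t by (simp add: slit_bundle_def)
    let ?t = "(p, \<lambda>d. r *\<^sub>R v d)"
    have "?t \<in> tangent_bundle A"
      using scaleR_in_tangent_space[OF A v] by (simp add: tangent_bundle_def)
    moreover have "induced c ?t = (x, r *\<^sub>R y)" using t(3) by (simp add: induced_def)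
    ultimately have "induced_inv A c (x, r *\<^sub>R y) = ?t"
      using induced_inv_induced[OF A c, of ?t] t(2) by simp
    moreover have "F ?t = r * F (p, v)"
      using F v r unfolding finsler_metric_def tangent_bundle_def by auto
    ultimately show ?thesis using t(4) by simp
  qed
qed

lemma twisted_product_coordinates:
  fixes A1 :: "('a::topological_space, 'm::finite) chart set"
    and A2 :: "('b::topological_space, 'n::finite) chart set"
  assumes A: "smooth_atlas A1" "smooth_atlas A2"
    and F: "finsler_metric A1 F1" "finsler_metric A2 F2"
    and f: "product_smooth A1 A2 f" "\<And>p q. 0 < f (p, q)"
    and c: "c1 \<in> A1" "c2 \<in> A2"
  shows "coordinate_twisted_product (snd c1 ` fst c1) (F1 \<circ> induced_inv A1 c1)
    (snd c2 ` fst c2) (F2 \<circ> induced_inv A2 c2) (\<lambda>(x1, x2). f (chart_inv c1 x1, chart_inv c2 x2))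
    (twisted_product F1 F2 f \<circ> product_induced_inv A1 A2 c1 c2)"
proof (intro coordinate_twisted_product.intro coordinate_twisted_product_axioms.intro
    finsler_metric_coordinates A F c)
  show "smooth_on (snd c1 ` fst c1 \<times> snd c2 ` fst c2) (\<lambda>(x1, x2). f (chart_inv c1 x1, chart_inv c2 x2))"
    using f(1) c by (simp add: product_smooth_def)
  show "0 < (\<lambda>(x1, x2). f (chart_inv c1 x1, chart_inv c2 x2)) (u, w)" for u w
    by (simp add: f(2))
  fix x y :: "real^('m + 'n)"
  assume x: "left_part x \<in> snd c1 ` fst c1" "right_part x \<in> snd c2 ` fst c2"
    and y: "left_part y \<noteq> 0" "right_part y \<noteq> 0"
  obtain t1 where t1: "induced_inv A1 c1 (left_part x, left_part y) = t1" "chart_inv c1 (left_part x) = fst t1"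
    using slit_bundle_coordinates[OF A(1) c(1) x(1) y(1)] by metis
  obtain t2 where t2: "induced_inv A2 c2 (right_part x, right_part y) = t2" "chart_inv c2 (right_part x) = fst t2"
    using slit_bundle_coordinates[OF A(2) c(2) x(2) y(2)] by metis
  show "(twisted_product F1 F2 f \<circ> product_induced_inv A1 A2 c1 c2) (x, y) =
      sqrt (((F1 \<circ> induced_inv A1 c1) (left_part x, left_part y))\<^sup>2 +
        ((\<lambda>(x1, x2). f (chart_inv c1 x1, chart_inv c2 x2)) (left_part x, right_part x))\<^sup>2 *
        ((F2 \<circ> induced_inv A2 c2) (right_part x, right_part y))\<^sup>2)"
    by (simp add: twisted_product_def product_induced_inv_def t1 t2)
qed

theorem theorem4p5:
  fixes A1 :: "('a::{t2_space, second_countable_topology}, 'm::finite) chart set"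
    and A2 :: "('b::{t2_space, second_countable_topology}, 'n::finite) chart set"
    and F1 :: "'a \<times> ('a, 'm) tvec \<Rightarrow> real"
    and F2 :: "'b \<times> ('b, 'n) tvec \<Rightarrow> real"
    and f :: "'a \<times> 'b \<Rightarrow> real"
  assumes "smooth_atlas A1" and "smooth_atlas A2"
    and "finsler_metric A1 F1" and "finsler_metric A2 F2"
    and "product_smooth A1 A2 f" and "\<And>p q. 0 < f (p, q)"
  shows "relatively_isotropic_landsberg A1 A2 (twisted_product F1 F2 f) \<longleftrightarrow>
         landsberg_metric A1 A2 (twisted_product F1 F2 f)"
proof
  assume "landsberg_metric A1 A2 (twisted_product F1 F2 f)"
  then show "relatively_isotropic_landsberg A1 A2 (twisted_product F1 F2 f)"
    unfolding relatively_isotropic_landsberg_def landsberg_metric_def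
    by (intro exI[of _ "\<lambda>_. 0"]) simp
next
  assume "relatively_isotropic_landsberg A1 A2 (twisted_product F1 F2 f)"
  then obtain c where iso: "\<And>c1 c2 t1 t2 \<alpha> \<beta> \<gamma>. c1 \<in> A1 \<Longrightarrow> c2 \<in> A2 \<Longrightarrow>
      t1 \<in> slit_bundle A1 \<Longrightarrow> t2 \<in> slit_bundle A2 \<Longrightarrow> fst t1 \<in> fst c1 \<Longrightarrow> fst t2 \<in> fst c2 \<Longrightarrow>
      landsberg (twisted_product F1 F2 f \<circ> product_induced_inv A1 A2 c1 c2) \<alpha> \<beta> \<gamma> (product_induced c1 c2 (t1, t2))
      + c (fst t1, fst t2) * twisted_product F1 F2 f (t1, t2)
        * cartan (twisted_product F1 F2 f \<circ> product_induced_inv A1 A2 c1 c2) \<alpha> \<beta> \<gamma>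
            (product_induced c1 c2 (t1, t2)) = 0"
    unfolding relatively_isotropic_landsberg_def by blast
  show "landsberg_metric A1 A2 (twisted_product F1 F2 f)"
    unfolding landsberg_metric_def
  proof (intro ballI impI allI)
    fix c1 c2 t1 t2 \<alpha> \<beta> \<gamma>
    assume c: "c1 \<in> A1" "c2 \<in> A2" and t: "t1 \<in> slit_bundle A1" "t2 \<in> slit_bundle A2"
      and p: "fst t1 \<in> fst c1" "fst t2 \<in> fst c2"
    define F where "F = twisted_product F1 F2 f \<circ> product_induced_inv A1 A2 c1 c2"
    interpret coordinate_twisted_product "snd c1 ` fst c1" "F1 \<circ> induced_inv A1 c1"
      "snd c2 ` fst c2" "F2 \<circ> induced_inv A2 c2" "\<lambda>(x1, x2). f (chart_inv c1 x1, chart_inv c2 x2)" F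
      unfolding F_def by (rule twisted_product_coordinates[OF assms c])
    define x1 y1 x2 y2 where "x1 = fst (induced c1 t1)" and "y1 = snd (induced c1 t1)"
      and "x2 = fst (induced c2 t2)" and "y2 = snd (induced c2 t2)"
    have "induced c1 t1 \<in> snd c1 ` fst c1 \<times> (UNIV - {0})" "induced c2 t2 \<in> snd c2 ` fst c2 \<times> (UNIV - {0})"
      using induced_slit_bundle[OF assms(1) c(1)] induced_slit_bundle[OF assms(2) c(2)] t p by blast+
    then have x: "x1 \<in> snd c1 ` fst c1" "x2 \<in> snd c2 ` fst c2" and y: "y1 \<noteq> 0" "y2 \<noteq> 0"
      by (auto simp: x1_def x2_def y1_def y2_def)
    have "landsberg F \<alpha> \<beta> \<gamma> (join x1 x2, join y1 y2) = 0"
    proof (rule isotropic_imp_landsberg[where \<kappa> = "c (chart_inv c1 x1, chart_inv c2 x2)"])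
      \<comment> \<open>every such \<open>y\<close> comes from slit tangent vectors at the same pair of points\<close>
      fix y :: "real^('m + 'n)" assume y: "left_part y \<noteq> 0" "right_part y \<noteq> 0"
      obtain s1 where s1: "s1 \<in> slit_bundle A1" "fst s1 \<in> fst c1" "induced c1 s1 = (x1, left_part y)"
        "induced_inv A1 c1 (x1, left_part y) = s1" "chart_inv c1 x1 = fst s1"
        using slit_bundle_coordinates[OF assms(1) c(1) x(1) y(1)] .
      obtain s2 where s2: "s2 \<in> slit_bundle A2" "fst s2 \<in> fst c2" "induced c2 s2 = (x2, right_part y)"
        "induced_inv A2 c2 (x2, right_part y) = s2" "chart_inv c2 x2 = fst s2"
        using slit_bundle_coordinates[OF assms(2) c(2) x(2) y(2)] .
      have "product_induced c1 c2 (s1, s2) = (join x1 x2, y)"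
        by (simp add: product_induced_def s1 s2)
      moreover have "F (join x1 x2, y) = twisted_product F1 F2 f (s1, s2)"
        by (simp add: F_def product_induced_inv_def s1 s2)
      ultimately show "landsberg F \<alpha> \<beta> \<gamma> (join x1 x2, y) + c (chart_inv c1 x1, chart_inv c2 x2)
          * F (join x1 x2, y) * cartan F \<alpha> \<beta> \<gamma> (join x1 x2, y) = 0"
        using iso[OF c s1(1) s2(1) s1(2) s2(2), folded F_def] by (simp add: s1(5) s2(5))
    qed (simp_all add: x y)
    then show "landsberg (twisted_product F1 F2 f \<circ> product_induced_inv A1 A2 c1 c2) \<alpha> \<beta> \<gamma>
        (product_induced c1 c2 (t1, t2)) = 0"
      by (simp add: F_def product_induced_def x1_def x2_def y1_def y2_def)
  qed
qed

end
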